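(* Let $n \geq 4$ be an integer. Then the main diagonal section $Q_n \cap \mathbf{1}_n^\perp$ has strictly locally maximal volume among central sections of $Q_n$. That is, the function $\sigma$ restricted to the unit sphere $S^{n-1}$ has a strict local maximum at $\mathbf{d}_n = \frac{1}{\sqrt n}\mathbf{1}_n$: there is a neighbourhood $U$ of $\mathbf{d}_n$ in $S^{n-1}$ such that $\sigma(\mathbf{v}) < \sigma(\mathbf{d}_n)$ for every $\mathbf{v}\in U\setminus\{\mathbf{d}_n\}$.
   Context: $Q_n = [-\frac12,\frac12]^n\subset\mathbb{R}^n$ is the centered unit cube. For a non-zero vector $\mathbf{v}\in\mathbb{R}^n$, $\mathbf{v}^\perp$ is the linear hyperplane orthogonal to $\mathbf{v}$, and the central section function is $\sigma(\mathbf{v}) = \mathrm{Vol}_{n-1}(Q_n\cap \mathbf{v}^\perp)$, the $(n-1)$-dimensional volume. It is invariant under scaling $\mathbf{v}$ by non-zero factors. $\mathbf{1}_n = (1,\ldots,1)\in\mathbb{R}^n$, and $S^{n-1}$ is the Euclidean unit sphere in $\mathbb{R}^n$. Local extremality of a central section is defined as local extremality of $\sigma|_{S^{n-1}}$ at its unit normal. *)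

theory Defs
  imports "HOL-Analysis.Analysis"
begin

definition orthonormal_basis_of :: "'a::euclidean_space set \<Rightarrow> 'a set \<Rightarrow> bool" where
  "orthonormal_basis_of H B \<longleftrightarrow>
     B \<subseteq> H \<and> pairwise orthogonal B \<and> (\<forall>b\<in>B. norm b = 1) \<and> span B = H"

lemma orthonormal_basis_of_exists:
  fixes H :: "'a::euclidean_space set"
  assumes "subspace H"
  shows "\<exists>B. orthonormal_basis_of H B"
  using orthonormal_basis_subspace[OF assms] unfolding orthonormal_basis_of_def by metis

text \<open>
  The Lebesgue measure of a linear subspace H, of dimension dim H, as a Borel measure on the ambient
  space. It is the image of a product of copies of the Lebesgue measure on the line under the
  coordinate isometry given by an orthonormal basis of H, just as lborel is built from the standard
  basis. The measure does not depend on the orthonormal basis chosen.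
\<close>

definition subspace_lborel :: "'a::euclidean_space set \<Rightarrow> 'a measure" where
  "subspace_lborel H =
     (let B = (SOME B. orthonormal_basis_of H B)
      in distr (Pi\<^sub>M B (\<lambda>_. lborel :: real measure)) borel (\<lambda>f. \<Sum>b\<in>B. f b *\<^sub>R b))"

definition centered_cube :: "(real^'n) set" where
  "centered_cube = {x. \<forall>i. -1/2 \<le> x $ i \<and> x $ i \<le> 1/2}"

definition orth_hyperplane :: "real^'n \<Rightarrow> (real^'n) set" where
  "orth_hyperplane v = {x. v \<bullet> x = 0}"

text \<open>Meaningful for non-zero vectors only, where the hyperplane has dimension n - 1.\<close>

definition central_section :: "real^'n \<Rightarrow> real" where
  "central_section v =
     measure (subspace_lborel (orth_hyperplane v)) (centered_cube \<inter> orth_hyperplane v)"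

definition ones :: "real^'n" where
  "ones = (\<chi> i. 1)"

definition main_diagonal :: "real^'n" where
  "main_diagonal = (1 / sqrt (real CARD('n))) *\<^sub>R ones"

end

theory Submission
  imports Defs
begin

text \<open>Projecting the section along a coordinate axis gives, for positive coordinates v_i,
  \<sigma>(v) = (|v| / v_j) P(|\<Sum>_{i \<noteq> j} v_i X_i| \<le> v_j / 2) with the X_i independent and uniform on [-1/2, 1/2].
  Splitting off a second coordinate v_i, the probability becomes the expectation of a trapezoid
  evaluated at the sum Z of the remaining terms, and this trapezoid is a difference of two tents, one of
  half-width (v_i + v_j)/2 and one of half-width |v_i - v_j|/2. So when v_i + v_j is kept and
  |v_i - v_j| grows, only the second tent matters, and \<sigma> decreases near the diagonal as soon as
  (1 + 1/n) f_n(0) < f_{n-2}(0), where f_m is the density of X_1 + ... + X_m. Finitely many such moves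
  lead from the diagonal to any nearby vector with the same coordinate sum, so neither second
  derivatives nor compactness are needed. The inequality for the densities follows from an upper bound
  for the ratios f_m(x + 1/2) / f_m(x - 1/2) that is preserved by the B-spline recursion.\<close>

section \<open>Densities of sums of uniform variables\<close>

text \<open>The threshold for the densities comes from three effects of one spread, all measured by
  \<Delta>, the increase of (v_i - v_j)^2 / 4. The product v_i v_j drops by \<Delta>, |v|^2 rises by
  2 \<Delta>, and, because one further variable X_k is integrated out, the mean of the narrow tent
  rises by at least \<Delta> \<kappa> with \<kappa> close to f_{n-2}(0). At the all-ones vector the
  first two raise \<sigma> by the relative amount \<Delta> + \<Delta> / n to first order, and the
  third lowers it by \<Delta> f_{n-2}(0) / f_n(0). The third effect is bounded for finite moves, so
  an inequality at the all-ones vector that survives with a margin on a neighbourhood is enough. The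
  obstacle is how thin this inequality is. By the local limit theorem f_{n-2}(0) / f_n(0) = 1 + 1/n
  + O(1/n^2), so the leading Gaussian term decides nothing, and at n = 3 both sides are equal, as
  f_1(0) = 1 and f_3(0) = 3/4. Hence the exact recursion and a rational bound for the
  ratios.\<close>

lemma alternating_pascal_sum:
  fixes a :: "nat \<Rightarrow> real"
  shows "(\<Sum>k\<le>Suc N. (-1)^k * real (Suc N choose k) * a k) =
         (\<Sum>k\<le>N. (-1)^k * real (N choose k) * (a k - a (Suc k)))"
proof -
  have split: "(-1)^Suc k * real (Suc N choose Suc k) * a (Suc k) =
      (-1)^Suc k * real (N choose Suc k) * a (Suc k) - (-1)^k * real (N choose k) * a (Suc k)" for k
    unfolding binomial_Suc_Suc of_nat_add distrib_left distrib_right by simp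
  have "(\<Sum>k\<le>Suc N. (-1)^k * real (Suc N choose k) * a k) =
        (a 0 + (\<Sum>k\<le>N. (-1)^Suc k * real (N choose Suc k) * a (Suc k)))
            - (\<Sum>k\<le>N. (-1)^k * real (N choose k) * a (Suc k))"
    unfolding sum.atMost_Suc_shift split sum_subtractf by simp
  also have "a 0 + (\<Sum>k\<le>N. (-1)^Suc k * real (N choose Suc k) * a (Suc k)) =
             (\<Sum>k\<le>Suc N. (-1)^k * real (N choose k) * a k)"
    unfolding sum.atMost_Suc_shift by simp
  also have "\<dots> = (\<Sum>k\<le>N. (-1)^k * real (N choose k) * a k)"
    by simp
  finally show ?thesis
    unfolding right_diff_distrib sum_subtractf .
qed

text \<open>By absorption, (k + 1) C(N, k + 1) = (N - k) C(N, k), so the two halves cancel after an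
  index shift. This removes from the spline recursion the terms that carry the knot index k as a
  factor.\<close>

lemma alternating_absorption_sum:
  fixes a :: "nat \<Rightarrow> real"
  shows "(\<Sum>k\<le>N. (-1)^k * real (N choose k) * (real k * a k + (real N - real k) * a (Suc k))) = 0"
proof -
  have absorb: "real (Suc k) * real (N choose Suc k) = (real N - real k) * real (N choose k)" if "k \<le> N" for k
  proof -
    have "Suc k * (N choose Suc k) = (N - k) * (N choose k)"
      by (rule trans[OF binomial_absorption binomial_absorb_comp[symmetric]])
    then have "real (Suc k * (N choose Suc k)) = real ((N - k) * (N choose k))" by (rule arg_cong)
    then show ?thesis
      unfolding of_nat_mult of_nat_diff[OF that] .
  qed
  have summand: "(-1)^Suc k * real (N choose Suc k) * (real (Suc k) * a (Suc k)) =
      - ((-1)^k * real (N choose k) * ((real N - real k) * a (Suc k)))" if "k \<le> N" for k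
  proof -
    have "(-1)^Suc k * real (N choose Suc k) * (real (Suc k) * a (Suc k)) =
        - ((-1)^k * (real (Suc k) * real (N choose Suc k)) * a (Suc k))"
      by simp
    then show ?thesis unfolding absorb[OF that] by (simp add: mult.commute mult.left_commute)
  qed
  have "(\<Sum>k\<le>N. (-1)^k * real (N choose k) * (real k * a k)) =
        (\<Sum>k\<le>Suc N. (-1)^k * real (N choose k) * (real k * a k))"
    by simp
  also have "\<dots> = (\<Sum>k\<le>N. (-1)^Suc k * real (N choose Suc k) * (real (Suc k) * a (Suc k)))"
    unfolding sum.atMost_Suc_shift by simp
  also have "\<dots> = (\<Sum>k\<le>N. - ((-1)^k * real (N choose k) * ((real N - real k) * a (Suc k))))"
    using summand by (intro sum.cong) auto
  finally show ?thesis
    unfolding distrib_left sum.distrib sum_negf by simp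
qed

text \<open>The N-th central difference, with step 1, of the truncated power of degree d. The two
  parameters are independent because differencing changes only N and differentiation only d.\<close>

definition trunc_pow_sum :: "nat \<Rightarrow> nat \<Rightarrow> real \<Rightarrow> real" where
  "trunc_pow_sum N d x =
     (\<Sum>k\<le>N. (-1)^k * real (N choose k) * (max 0 (x + real N / 2 - real k))^d)"

text \<open>For m \<ge> 1 this is the density of a sum of m + 1 independent variables that are uniform on
  [-1/2, 1/2]. At m = 0 it is not, since 0^0 = 1.\<close>

definition spline :: "nat \<Rightarrow> real \<Rightarrow> real" where
  "spline m x = trunc_pow_sum (Suc m) m x / fact m"

lemma trunc_pow_sum_Suc:
  "trunc_pow_sum (Suc N) d x = trunc_pow_sum N d (x + 1/2) - trunc_pow_sum N d (x - 1/2)"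
proof -
  have shift: "x + real (Suc N) / 2 - real k = (x + 1/2) + real N / 2 - real k"
    "x + real (Suc N) / 2 - real (Suc k) = (x - 1/2) + real N / 2 - real k" for k
    by (simp_all add: field_simps)
  have "trunc_pow_sum (Suc N) d x = (\<Sum>k\<le>N. (-1)^k * real (N choose k) *
      ((max 0 (x + real (Suc N) / 2 - real k))^d - (max 0 (x + real (Suc N) / 2 - real (Suc k)))^d))"
    unfolding trunc_pow_sum_def by (rule alternating_pascal_sum)
  then show ?thesis
    unfolding shift(2) unfolding shift(1) right_diff_distrib sum_subtractf unfolding trunc_pow_sum_def .
qed

text \<open>The Cox-de Boor recursion for uniform B-splines centred at 0. One affine factor is
  pulled out of each truncated power, and Pascal's rule distributes it over the two shifts by
  1/2.\<close>

lemma spline_rec: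
  assumes "m \<ge> 1"
  shows "real (Suc m) * spline (Suc m) x =
    (real (m + 2) / 2 + x) * spline m (x + 1/2) + (real (m + 2) / 2 - x) * spline m (x - 1/2)"
proof -
  define N where "N = Suc m"
  define M where "M = real (Suc N) / 2"
  define u where "u k = x + M - real k" for k
  define a where "a k = (max 0 (u k))^m" for k
  have shift: "trunc_pow_sum N m (x + 1/2) = (\<Sum>k\<le>N. (-1)^k * real (N choose k) * a k)"
              "trunc_pow_sum N m (x - 1/2) = (\<Sum>k\<le>N. (-1)^k * real (N choose k) * a (Suc k))"
    unfolding trunc_pow_sum_def a_def u_def M_def by (simp_all add: field_simps)
  \<comment> \<open>One factor \<open>max 0 (u k)\<close> may be replaced by \<open>u k\<close>,
    since the remaining power already vanishes for negative \<open>u k\<close>. For m = 0 this fails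
    because 0^0 = 1.\<close>
  have "trunc_pow_sum (Suc N) (Suc m) x = (\<Sum>k\<le>Suc N. (-1)^k * real (Suc N choose k) * (u k * a k))"
    unfolding trunc_pow_sum_def u_def a_def M_def using assms
    by (intro sum.cong refl arg_cong2[where f = "(*)"]) (auto simp: max_def)
  also have "\<dots> = (\<Sum>k\<le>N. (-1)^k * real (N choose k) * (u k * a k - u (Suc k) * a (Suc k)))"
    by (rule alternating_pascal_sum)
  \<comment> \<open>As 2 M = N + 1, the weight - \<open>u (Suc k)\<close> equals (M - x) - (N - k),
    and \<open>u k\<close> equals (M + x) - k; the parts with k form the absorption sum.\<close>
  also have "\<dots> = (\<Sum>k\<le>N. (-1)^k * real (N choose k) * ((M + x) * a k + (M - x) * a (Suc k)))
     - (\<Sum>k\<le>N. (-1)^k * real (N choose k) * (real k * a k + (real N - real k) * a (Suc k)))"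
    unfolding sum_subtractf[symmetric]
    by (intro sum.cong refl) (simp add: u_def M_def field_simps)
  also have "\<dots> = (M + x) * trunc_pow_sum N m (x + 1/2) + (M - x) * trunc_pow_sum N m (x - 1/2)"
    unfolding alternating_absorption_sum shift
    unfolding sum_distrib_left sum.distrib[symmetric] diff_0_right by (intro sum.cong refl) (simp add: algebra_simps)
  finally have eq: "trunc_pow_sum (Suc N) (Suc m) x =
    (M + x) * trunc_pow_sum N m (x + 1/2) + (M - x) * trunc_pow_sum N m (x - 1/2)" .
  have "real (Suc m) * spline (Suc m) x = trunc_pow_sum (Suc N) (Suc m) x / fact m"
    unfolding spline_def N_def by (simp add: fact_Suc del: of_nat_Suc)
  also have "\<dots> = (M + x) * spline m (x + 1/2) + (M - x) * spline m (x - 1/2)"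
    unfolding spline_def N_def[symmetric] times_divide_eq_right add_divide_distrib[symmetric] using eq by (simp only: N_def)
  finally show ?thesis
    unfolding M_def N_def by simp
qed

lemma spline_1: "spline 1 x = max 0 (1 - \<bar>x\<bar>)"
  unfolding spline_def trunc_pow_sum_def
  by (simp add: numeral_2_eq_2 max_def abs_if)

lemma spline_eq_0_left: "m \<ge> 1 \<Longrightarrow> x \<le> - real (Suc m) / 2 \<Longrightarrow> spline m x = 0"
proof -
  assume m: "m \<ge> 1" and x: "x \<le> - real (Suc m) / 2"
  have "max 0 (x + real (Suc m) / 2 - real k) = 0" for k using x by (intro max_absorb1) linarith
  moreover have "(0::real)^m = 0" using m by (simp add: power_0_left)
  ultimately show ?thesis unfolding spline_def trunc_pow_sum_def by (simp only: mult_zero_right sum.neutral_const div_0)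
qed

text \<open>Truncated powers are one-sided, so the closed formula hides the symmetry, but the
  recursion shows it. Vanishing to the right of the support then follows from vanishing to the
  left.\<close>

lemma spline_minus: "m \<ge> 1 \<Longrightarrow> spline m (- x) = spline m x"
proof (induction m arbitrary: x rule: nat_induct_at_least)
  case base
  show ?case using spline_1 by simp
next
  case (Suc m)
  have "real (Suc m) * spline (Suc m) (- x) = real (Suc m) * spline (Suc m) x"
    unfolding spline_rec[OF Suc.hyps]
    using Suc.IH[of "x - 1/2"] Suc.IH[of "x + 1/2"] by (simp add: algebra_simps)
  then show ?case by simp
qed

lemma spline_eq_0_right: "m \<ge> 1 \<Longrightarrow> x \<ge> real (Suc m) / 2 \<Longrightarrow> spline m x = 0"
  using spline_eq_0_left[of m "-x"] spline_minus[of m x] by simp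

text \<open>The closed formula has alternating signs, but inside the support both weights of the
  recursion are nonnegative.\<close>

lemma spline_nonneg: "m \<ge> 1 \<Longrightarrow> spline m x \<ge> 0"
proof (induction m arbitrary: x rule: nat_induct_at_least)
  case base
  show ?case using spline_1 by simp
next
  case (Suc m)
  show ?case
  proof (cases "\<bar>x\<bar> < real (m + 2) / 2")
    case True
    then have "real (m + 2) / 2 + x \<ge> 0" "real (m + 2) / 2 - x \<ge> 0"
      unfolding abs_less_iff by linarith+
    note nn = this
    have "real (Suc m) * spline (Suc m) x \<ge> 0"
      unfolding spline_rec[OF Suc.hyps]
      by (rule add_nonneg_nonneg[OF mult_nonneg_nonneg[OF nn(1) Suc.IH] mult_nonneg_nonneg[OF nn(2) Suc.IH]])
    then show ?thesis by (simp add: zero_le_mult_iff)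
  next
    case False
    then show ?thesis
      using spline_eq_0_left[of "Suc m" x] spline_eq_0_right[of "Suc m" x] by (cases "x \<ge> 0") auto
  qed
qed

text \<open>The polynomial is even, namely 2 M A^3 + 6 A (M - A) x^2 - 2 x^4. The hypothesis caps
  its quadratic coefficient at 2, exactly what the step from 0 to 1 permits; later steps are more
  favourable.\<close>

lemma quartic_decreasing:
  fixes A M x :: real
  assumes "x \<ge> 0" "3 * A * (M - A) \<le> 1"
  shows "(M + x + 1) * (A - x - 1)^3 + (M - x - 1) * (A + x + 1)^3
         \<le> (M + x) * (A - x)^3 + (M - x) * (A + x)^3"
proof -
  have "(M + x) * (A - x)^3 + (M - x) * (A + x)^3
      - ((M + x + 1) * (A - x - 1)^3 + (M - x - 1) * (A + x + 1)^3)
      = (2 * x + 1) * (2 * ((x + 1)^2 + x^2) - 6 * A * (M - A))"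
    by (simp add: power3_eq_cube power2_eq_square algebra_simps)
  moreover have "(x + 1)^2 + x^2 \<ge> 1"
    using assms(1) by (simp add: power2_eq_square algebra_simps)
  then have "(2 * x + 1) * (2 * ((x + 1)^2 + x^2) - 6 * A * (M - A)) \<ge> 0"
    using assms by (intro mult_nonneg_nonneg) auto
  ultimately show ?thesis by linarith
qed

text \<open>The cubic is what makes the bound reproduce itself under the recursion: after clearing
  denominators the induction step is exactly quartic_decreasing. The correction 1/(3 M) is needed,
  as A = M would lose the final comparison at order 1/m^3.\<close>

lemma spline_ratio_bound:
  assumes "m \<ge> 1"
  defines "A \<equiv> \<lambda>m. real (m + 2) / 2 - 2 / (3 * real (m + 2))"
  shows "j \<le> Suc m \<Longrightarrow> spline m (real j / 2 + 1/2) * (A m + real j / 2)^3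
           \<le> spline m (real j / 2 - 1/2) * (A m - real j / 2)^3"
  using assms(1)
proof (induction m arbitrary: j rule: nat_induct_at_least)
  case base
  then consider "j = 0" | "j \<ge> 1" by linarith
  then show ?case
  proof cases
    case 1
    then show ?thesis using spline_1 by simp
  next
    case 2
    then have "spline 1 (real j / 2 + 1/2) = 0" by (intro spline_eq_0_right) auto
    moreover have "A 1 \<ge> real j / 2" using base by (simp add: A_def)
    ultimately show ?thesis using spline_nonneg[of 1] by simp
  qed
next
  case (Suc m)
  define M where "M = real (m + 2) / 2"
  define B where "B = A (Suc m)"
  define A' where "A' = A m"
  have M: "M \<ge> 3/2" using Suc.hyps by (simp add: M_def)
  have A': "A' = M - 1 / (3 * M)" unfolding A'_def A_def M_def by (simp add: field_simps)
  have "1 / (3 * M) \<le> 2/9" using M by (simp add: field_simps)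
  then have A'_low: "A' > M - 1/2" and A'_pos: "A' > 0" using A' M by linarith+
  have A'_up: "A' \<le> M" using A' M by simp
  have "B = M + 1/2 - 1 / (3 * (M + 1/2))"
    unfolding B_def A_def M_def by (simp add: field_simps)
  moreover have "1 / (3 * (M + 1/2)) \<le> 1 / (3 * M)" using M by (intro divide_left_mono) auto
  ultimately have B: "B \<ge> A' + 1/2" using A' by simp
  show ?case
  proof (cases j)
    case 0
    then show ?thesis using spline_minus[of "Suc m" "1/2"] by (simp add: A_def)
  next
    case (Suc i)
    define x where "x = real i / 2"
    have y: "real j / 2 = x + 1/2" using Suc by (simp add: x_def add_divide_distrib)
    have e: "x + 1/2 + 1/2 = x + 1" "x + 1/2 - 1/2 = x" by simp_all
    have x0: "x \<ge> 0" by (simp add: x_def)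
    have "i \<le> Suc m" using Suc Suc.prems by simp
    then have xM: "x \<le> M - 1/2" by (simp add: x_def M_def add_divide_distrib)
    have xB: "B - (x + 1/2) > 0" using xM B A'_low by linarith
    show ?thesis
    \<comment> \<open>The induction hypothesis is used at \<open>i\<close> and at
      \<open>i + 2\<close>. When \<open>i + 2\<close> is beyond its range, \<open>x + 1\<close> has
      reached the end of the support of the new spline and the left-hand side is 0.\<close>
    proof (cases "Suc (Suc i) \<le> Suc m")
      case False
      then have "real i + 2 \<ge> real m + 2" by linarith
      then have "spline (Suc m) (x + 1) = 0"
        by (intro spline_eq_0_right) (auto simp: x_def field_simps)
      then show ?thesis
        unfolding y e B_def[symmetric] using xB spline_nonneg[of "Suc m" x] by simp
    next
      case True
      then have xM1: "x + 1 \<le> M - 1/2" by (simp add: x_def M_def field_simps)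
      define r where "r = (A' - x)^3"
      define r' where "r' = (A' + x)^3"
      define t where "t = (A' - x - 1)^3"
      define t' where "t' = (A' + x + 1)^3"
      define a where "a = spline m (x - 1/2)"
      define b where "b = spline m (x + 1/2)"
      define c where "c = spline m (x + 3/2)"
      have pos: "r > 0" "r' > 0" "t > 0" "t' > 0"
        unfolding r_def r'_def t_def t'_def using xM1 A'_low x0 A'_pos by (auto intro!: zero_less_power)
      have nn: "a \<ge> 0" "b \<ge> 0" "c \<ge> 0"
        unfolding a_def b_def c_def using spline_nonneg[OF Suc.hyps] by auto
      have i1: "b * r' \<le> a * r"
        using Suc.IH[of i] \<open>i \<le> Suc m\<close> unfolding x_def[symmetric] a_def b_def r_def r'_def A'_def by simp
      have i2: "c * t' \<le> b * t"
        using Suc.IH[of "Suc (Suc i)"] True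
        unfolding c_def b_def t_def t'_def A'_def x_def by (simp add: add_divide_distrib algebra_simps)
      \<comment> \<open>This is the origin of the correction in \<open>A\<close>: a smaller
        \<open>A\<close> gives a stronger ratio bound, and M - A = 1/(3 M) stays just within the
        hypothesis of \<open>quartic_decreasing\<close>.\<close>
      have "3 * A' * (M - A') = A' / M"
      proof -
        have "M - A' = 1 / (3 * M)" using A' by simp
        then show ?thesis by simp
      qed
      also have "\<dots> \<le> 1" using A'_up M by simp
      finally have quart: "(M + x + 1) * t + (M - x - 1) * t' \<le> (M + x) * r + (M - x) * r'"
        unfolding t_def t'_def r_def r'_def using quartic_decreasing[OF x0] by blast
      define L where "L = (M + x + 1) * c + (M - x - 1) * b"
      define R where "R = (M + x) * b + (M - x) * a"
      have "L * t' = (M + x + 1) * (c * t') + (M - x - 1) * b * t'"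
        by (simp add: L_def algebra_simps)
      also have "\<dots> \<le> (M + x + 1) * (b * t) + (M - x - 1) * b * t'"
        using i2 x0 M by (intro add_right_mono mult_left_mono) auto
      also have "\<dots> = b * ((M + x + 1) * t + (M - x - 1) * t')"
        by (simp add: algebra_simps)
      also have "\<dots> \<le> b * ((M + x) * r + (M - x) * r')"
        using quart nn by (intro mult_left_mono) auto
      also have "\<dots> = (M + x) * b * r + (M - x) * (b * r')"
        by (simp add: algebra_simps)
      also have "\<dots> \<le> (M + x) * b * r + (M - x) * (a * r)"
        using i1 xM by (intro add_left_mono mult_left_mono) auto
      also have "\<dots> = R * r" by (simp add: R_def algebra_simps)
      finally have main: "L * t' \<le> R * r" .
      have L0: "L \<ge> 0" and R0: "R \<ge> 0"
        unfolding L_def R_def using nn x0 xM xM1 M by (auto intro!: add_nonneg_nonneg mult_nonneg_nonneg)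
      \<comment> \<open>This passes from the cubic of level m to that of level m + 1. For
        \<open>B = A' + 1/2\<close> the two sides coincide, so all that matters is that
        \<open>A\<close> grows by at least 1/2 per level.\<close>
      have cross: "(B + (x + 1/2)) * (A' - x) \<le> (B - (x + 1/2)) * (A' + x + 1)"
      proof -
        have "(B - (x + 1/2)) * (A' + x + 1) - (B + (x + 1/2)) * (A' - x) = (2 * x + 1) * (B - (A' + 1/2))"
          by (simp add: field_simps)
        moreover have "\<dots> \<ge> 0" using x0 B by simp
        ultimately show ?thesis by linarith
      qed
      have "((B + (x + 1/2)) * (A' - x))^3 \<le> ((B - (x + 1/2)) * (A' + x + 1))^3"
        using cross x0 xM A'_low B by (intro power_mono) auto
      then have cross3: "(B + (x + 1/2))^3 * r \<le> (B - (x + 1/2))^3 * t'"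
        unfolding r_def t'_def power_mult_distrib .
      have "L * (B + (x + 1/2))^3 * r * t' = (L * t') * ((B + (x + 1/2))^3 * r)"
        by simp
      also have "\<dots> \<le> (R * r) * ((B - (x + 1/2))^3 * t')"
        using pos x0 B A'_pos by (intro mult_mono[OF main cross3] mult_nonneg_nonneg[OF R0]) auto
      also have "\<dots> = R * (B - (x + 1/2))^3 * r * t'" by simp
      finally have fin: "L * (B + (x + 1/2))^3 \<le> R * (B - (x + 1/2))^3"
        using pos by (simp add: mult_le_cancel_right_pos)
      have "real (Suc m) * spline (Suc m) (x + 1) = L"
        using spline_rec[OF Suc.hyps, of "x + 1"] by (simp add: L_def b_def c_def M_def algebra_simps)
      moreover have "real (Suc m) * spline (Suc m) x = R"
        using spline_rec[OF Suc.hyps, of x] by (simp add: R_def b_def a_def M_def)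
      ultimately have "real (Suc m) * (spline (Suc m) (x + 1) * (B + (x + 1/2))^3)
          \<le> real (Suc m) * (spline (Suc m) x * (B - (x + 1/2))^3)"
        using fin by (simp only: mult.assoc[symmetric])
      then have "spline (Suc m) (x + 1) * (B + (x + 1/2))^3 \<le> spline (Suc m) x * (B - (x + 1/2))^3"
        by (subst (asm) mult_le_cancel_left_pos) auto
      then show ?thesis unfolding y e B_def[symmetric] .
    qed
  qed
qed

text \<open>Two recursion steps lead from 0 through 1/2 back to the arguments 0 and 1, so that only
  the ratio \<open>spline m 1 / spline m 0\<close> remains to be bounded.\<close>

lemma spline_at_0_rec2:
  assumes "m \<ge> 1"
  shows "spline (Suc (Suc m)) 0 = real (m + 3) / (real (m + 2) * real (m + 1)) *
    (real (m + 3) / 2 * spline m 1 + real (m + 1) / 2 * spline m 0)"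
proof -
  have "real (Suc (Suc m)) * spline (Suc (Suc m)) 0 = real (m + 3) * spline (Suc m) (1/2)"
    using spline_rec[of "Suc m" 0] spline_minus[of "Suc m" "1/2"] by (simp add: algebra_simps)
  moreover have "real (Suc m) * spline (Suc m) (1/2) = real (m + 3) / 2 * spline m 1 + real (m + 1) / 2 * spline m 0"
    using spline_rec[OF assms, of "1/2"] by (simp add: field_simps)
  ultimately have "spline (Suc (Suc m)) 0 = real (m + 3) * spline (Suc m) (1/2) / real (m + 2)"
    and "spline (Suc m) (1/2) = (real (m + 3) / 2 * spline m 1 + real (m + 1) / 2 * spline m 0) / real (m + 1)"
    by (simp_all add: eq_divide_eq mult.commute)
  then show ?thesis
    by (simp only: times_divide_eq_right times_divide_eq_left divide_divide_eq_left mult.commute)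
qed

lemma spline_at_0_pos: "m \<ge> 1 \<Longrightarrow> spline m 0 > 0"
proof (induction m rule: less_induct)
  case (less m)
  consider "m = 1" | "m = 2" | k where "k \<ge> 1" "m = Suc (Suc k)"
  proof -
    have "m = 1 \<or> m = 2 \<or> (m - 2 \<ge> 1 \<and> m = Suc (Suc (m - 2)))"
      using less.prems by linarith
    then show ?thesis using that by blast
  qed
  then show ?case
  proof cases
    case 1
    then show ?thesis using spline_1 by simp
  next
    case 2
    then show ?thesis using spline_rec[of 1 0] spline_1[of "1/2"] spline_1[of "-1/2"]
      by (simp add: numeral_2_eq_2)
  next
    case 3
    then have "spline k 0 > 0" using less by simp
    then show ?thesis
      unfolding 3(2) spline_at_0_rec2[OF 3(1)] using spline_nonneg[OF 3(1), of 1]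
      by (intro mult_pos_pos add_nonneg_pos mult_nonneg_nonneg) auto
  qed
qed

text \<open>For m = n - 3 this is (1 + 1/n) f_n(0) < f_{n-2}(0). With N = m + 2, a =
  \<open>spline m 0\<close> and b = \<open>spline m 1\<close>, the two-step recursion makes it
  equivalent to b (N + 1) (N + 2) < a (N - 1) (N - 2), and the ratio bound at j = 1 gives b / a
  \<le> ((y - 1) / (y + 1))^3.\<close>

lemma spline_curvature:
  assumes "m \<ge> 1"
  shows "(1 + 1 / real (m + 3)) * spline (Suc (Suc m)) 0 < spline m 0"
proof -
  define N where "N = real (m + 2)"
  define y where "y = N - 4 / (3 * N)"
  define a where "a = spline m 0"
  define b where "b = spline m 1"
  have N: "N \<ge> 3" using assms by (simp add: N_def)
  have a: "a > 0" unfolding a_def by (rule spline_at_0_pos[OF assms])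
  have b: "b \<ge> 0" unfolding b_def by (rule spline_nonneg[OF assms])
  have d: "4 / (3 * N) \<le> 4/9" using N by (simp add: field_simps)
  then have y: "y > 1" "y \<le> N" using N by (auto simp: y_def)
  have A: "real (m + 2) / 2 - 2 / (3 * real (m + 2)) = y / 2"
    unfolding y_def N_def by (simp add: field_simps)
  have "b * (y/2 + 1/2)^3 \<le> a * (y/2 - 1/2)^3"
    using spline_ratio_bound[OF assms, of 1] unfolding A a_def b_def by simp
  then have "8 * (b * (y/2 + 1/2)^3) \<le> 8 * (a * (y/2 - 1/2)^3)" by simp
  then have ratio: "b * (y + 1)^3 \<le> a * (y - 1)^3"
    by (simp add: power3_eq_cube field_simps)
  \<comment> \<open>At y = N the right side minus the left would be 4 - 4 N^2 < 0. The correction e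
    = N - y, with N e = 4/3, changes the leading term to + 4 N^2.\<close>
  have cubic: "(y - 1)^3 * ((N + 1) * (N + 2)) < (y + 1)^3 * ((N - 1) * (N - 2))"
  proof -
    define e where "e = 4 / (3 * N)"
    have Ne: "N * e = 4/3" using N by (simp add: e_def)
    have "(y + 1)^3 * ((N - 1) * (N - 2)) - (y - 1)^3 * ((N + 1) * (N + 2))
        = 2 * ((N\<^sup>2 + 2) * (3 * y\<^sup>2 + 1) - 3 * N * y * (y\<^sup>2 + 3))"
      by (simp add: power3_eq_cube power2_eq_square algebra_simps)
    also have "(N\<^sup>2 + 2) * (3 * y\<^sup>2 + 1) - 3 * N * y * (y\<^sup>2 + 3) =
      3 * (N * e) * y\<^sup>2 + N\<^sup>2 + 6 * y\<^sup>2 + 2 - 9 * N * y"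
      unfolding y_def e_def[symmetric] by (simp add: power2_eq_square algebra_simps)
    also have "\<dots> = 10 * (N - e)\<^sup>2 + N\<^sup>2 + 2 - 9 * N * (N - e)"
      unfolding Ne by (simp add: y_def e_def)
    also have "\<dots> = 2 * N\<^sup>2 + 10 * e\<^sup>2 - 11 * (N * e) + 2"
      by (simp add: power2_eq_square algebra_simps)
    also have "\<dots> = 2 * N\<^sup>2 + 10 * e\<^sup>2 - 38/3" unfolding Ne by simp
    finally have eq: "(y + 1)^3 * ((N - 1) * (N - 2)) - (y - 1)^3 * ((N + 1) * (N + 2))
        = 2 * (2 * N\<^sup>2 + 10 * e\<^sup>2 - 38/3)" .
    have "2 * N\<^sup>2 + 10 * e\<^sup>2 - 38/3 > 0"
    proof -
      have "3 * 3 \<le> N * N" using N by (intro mult_mono) auto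
      then have "N\<^sup>2 \<ge> 9" by (simp add: power2_eq_square)
      then show ?thesis using zero_le_power2[of e] by linarith
    qed
    then have "(y + 1)^3 * ((N - 1) * (N - 2)) - (y - 1)^3 * ((N + 1) * (N + 2)) > 0"
      unfolding eq by simp
    then show ?thesis by (simp only: diff_gt_0_iff_gt)
  qed
  have "b * ((N + 1) * (N + 2)) * (y + 1)^3 = (b * (y + 1)^3) * ((N + 1) * (N + 2))" by simp
  also have "\<dots> \<le> (a * (y - 1)^3) * ((N + 1) * (N + 2))"
    using ratio N by (intro mult_right_mono) auto
  also have "\<dots> = a * ((y - 1)^3 * ((N + 1) * (N + 2)))" by simp
  also have "\<dots> < a * ((y + 1)^3 * ((N - 1) * (N - 2)))"
    using cubic a by (intro mult_strict_left_mono)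
  also have "\<dots> = a * ((N - 1) * (N - 2)) * (y + 1)^3" by simp
  finally have ab: "b * ((N + 1) * (N + 2)) < a * ((N - 1) * (N - 2))"
    using y by (simp add: mult_less_cancel_right_pos)
  have "(1 + 1 / real (m + 3)) * spline (Suc (Suc m)) 0 =
      (N + 2) / (2 * (N * (N - 1))) * ((N + 1) * b + (N - 1) * a)"
  proof -
    have c: "real (m + 3) = N + 1" "real (m + 1) = N - 1" "real (m + 2) = N" by (simp_all add: N_def)
    have "(1 + 1 / (N + 1)) * (N + 1) = N + 2" using N by (simp add: distrib_right)
    moreover have half: "(N + 1) / 2 * b + (N - 1) / 2 * a = ((N + 1) * b + (N - 1) * a) / 2"
      by simp
    ultimately have "(1 + 1 / (N + 1)) * ((N + 1) / (N * (N - 1)) * (((N + 1) * b + (N - 1) * a) / 2)) =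
      (N + 2) / (N * (N - 1)) * (((N + 1) * b + (N - 1) * a) / 2)"
      by (metis mult.assoc times_divide_eq_right)
    also have "(N + 2) / (N * (N - 1)) * (((N + 1) * b + (N - 1) * a) / 2) =
        (N + 2) / (2 * (N * (N - 1))) * ((N + 1) * b + (N - 1) * a)"
      by (simp only: times_divide_eq_right times_divide_eq_left divide_divide_eq_left ac_simps)
    finally show ?thesis
      unfolding spline_at_0_rec2[OF assms] a_def[symmetric] b_def[symmetric] c half .
  qed
  also have "\<dots> < a"
  proof -
    have "(N + 2) * ((N + 1) * b + (N - 1) * a) < a * (2 * (N * (N - 1)))"
      using ab by (simp add: algebra_simps)
    then show ?thesis using N by (simp add: pos_divide_less_eq)
  qed
  finally show ?thesis by (simp add: a_def)
qed

section \<open>Integrals of functions of a linear form over a cube\<close>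

lemma max_0_power_has_real_derivative:
  assumes "d \<ge> 1"
  shows "((\<lambda>y. (max 0 y)^Suc d) has_real_derivative real (Suc d) * (max 0 y)^d) (at y)"
proof -
  consider "y > 0" | "y < 0" | "y = 0" by linarith
  then show ?thesis
  proof cases
    case 1
    have "((\<lambda>y. y^Suc d) has_real_derivative real (Suc d) * y^d) (at y)"
      by (rule DERIV_cong[OF DERIV_pow]) simp
    then have "((\<lambda>y. (max 0 y)^Suc d) has_real_derivative real (Suc d) * y^d) (at y)"
      by (rule has_field_derivative_transform_within_open[where S = "{0<..}"]) (use 1 in auto)
    then show ?thesis using 1 by simp
  next
    case 2
    have "((\<lambda>y. 0) has_real_derivative 0) (at y)" by simp
    then have "((\<lambda>y. (max 0 y)^Suc d) has_real_derivative 0) (at y)"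
      by (rule has_field_derivative_transform_within_open[where S = "{..<0}"]) (use 2 in auto)
    then show ?thesis using 2 assms by (simp add: power_0_left)
  next
    case 3
    have "((\<lambda>h::real. (max 0 h)^d) \<longlongrightarrow> (max 0 0)^d) (at 0)"
      by (intro tendsto_intros)
    then have lim: "((\<lambda>h::real. (max 0 h)^d) \<longlongrightarrow> 0) (at 0)"
      using assms by (simp add: power_0_left)
    have "((\<lambda>h::real. ((max 0 (0 + h))^Suc d - (max 0 0)^Suc d) / h) \<longlongrightarrow> 0) (at 0)"
      by (rule Lim_transform_eventually[OF lim])
         (use assms in \<open>auto simp: eventually_at_filter max_def power_0_left\<close>)
    then show ?thesis
      using 3 assms by (simp add: DERIV_def power_0_left)
  qed
qed

lemma trunc_pow_sum_has_real_derivative: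
  assumes "d \<ge> 1"
  shows "((\<lambda>t. trunc_pow_sum N (Suc d) (x + t)) has_real_derivative
          real (Suc d) * trunc_pow_sum N d (x + t)) (at t)"
proof -
  have "((\<lambda>t. (-1)^k * real (N choose k) * (max 0 (x + t + real N / 2 - real k))^Suc d) has_real_derivative
      (-1)^k * real (N choose k) * (real (Suc d) * (max 0 (x + t + real N / 2 - real k))^d * 1)) (at t)" for k
    by (intro DERIV_cmult DERIV_chain2[where f = "\<lambda>y. (max 0 y)^Suc d"]
        max_0_power_has_real_derivative[OF assms]) (auto intro!: derivative_eq_intros)
  then have "((\<lambda>t. \<Sum>k\<le>N. (-1)^k * real (N choose k) * (max 0 (x + t + real N / 2 - real k))^Suc d) has_real_derivative
      (\<Sum>k\<le>N. (-1)^k * real (N choose k) * (real (Suc d) * (max 0 (x + t + real N / 2 - real k))^d * 1))) (at t)"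
    by (intro DERIV_sum) auto
  then show ?thesis
    unfolding trunc_pow_sum_def sum_distrib_left by (simp add: mult.assoc mult.left_commute)
qed

lemma spline_measurable [measurable]: "spline m \<in> borel_measurable borel"
  unfolding spline_def[abs_def] trunc_pow_sum_def by measurable

text \<open>Raising the degree d integrates the truncated power sum, and taking the increment over a
  unit interval adds one more difference. So convolution with the uniform density leads from one
  spline to the next.\<close>

lemma nn_integral_spline:
  assumes "m \<ge> 1"
  shows "(\<integral>\<^sup>+t\<in>{-1/2..1/2}. ennreal (spline m (x + t)) \<partial>lborel) = ennreal (spline (Suc m) x)"
proof -
  define F where "F t = trunc_pow_sum (Suc m) (Suc m) (x + t) / fact (Suc m)" for t
  have deriv: "(F has_real_derivative spline m (x + t)) (at t)" for t
    unfolding F_def spline_def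
    by (rule DERIV_cong[OF DERIV_cdivide[OF trunc_pow_sum_has_real_derivative[OF assms]]])
       (simp add: fact_Suc del: of_nat_Suc)
  have "(\<integral>\<^sup>+t\<in>{-1/2..1/2}. ennreal (spline m (x + t)) \<partial>lborel) = ennreal (F (1/2) - F (-1/2))"
    using spline_nonneg[OF assms]
    by (intro nn_integral_FTC_Icc) (auto intro!: has_field_derivative_at_within deriv)
  also have "F (1/2) - F (-1/2) = spline (Suc m) x"
    unfolding F_def spline_def trunc_pow_sum_Suc[of "Suc m"] by (simp add: diff_divide_distrib)
  finally show ?thesis .
qed

section \<open>Expectations of functions of a linear form in uniform variables\<close>

interpretation lborel_PiM: product_sigma_finite "\<lambda>_. lborel :: real measure"
  by standard

text \<open>The expectation of \<phi> at the weighted sum of independent uniform variables. The cube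
  appears as a product of indicators, so that coordinates split off by Fubini for product Lebesgue
  measure; values in \<open>ennreal\<close> avoid integrability side conditions.\<close>

definition cube_int :: "'i set \<Rightarrow> ('i \<Rightarrow> real) \<Rightarrow> (real \<Rightarrow> ennreal) \<Rightarrow> ennreal" where
  "cube_int I w \<phi> = (\<integral>\<^sup>+x. (\<Prod>i\<in>I. indicator {-1/2..1/2} (x i)) * \<phi> (\<Sum>i\<in>I. w i * x i) \<partial>Pi\<^sub>M I (\<lambda>_. lborel))"

lemma cube_int_empty: "cube_int {} w \<phi> = \<phi> 0"
  unfolding cube_int_def by (simp add: PiM_empty nn_integral_count_space_finite)

lemma cube_int_cong: "(\<And>i. i \<in> I \<Longrightarrow> w i = w' i) \<Longrightarrow> cube_int I w \<phi> = cube_int I w' \<phi>"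
  unfolding cube_int_def by (intro nn_integral_cong arg_cong2[where f = "(*)"] arg_cong[of _ _ \<phi>] sum.cong) auto

lemma cube_int_integrand_insert:
  assumes "finite I" "k \<notin> I"
  shows "(\<Prod>i\<in>insert k I. indicator {-1/2..1/2} ((x(k := t)) i)) * \<phi> (\<Sum>i\<in>insert k I. w i * (x(k := t)) i)
    = (\<Prod>i\<in>I. indicator {-1/2..1/2} (x i)) * (\<phi> (w k * t + (\<Sum>i\<in>I. w i * x i)) * indicator {-1/2..1/2::real} t :: ennreal)"
proof -
  have "(\<Prod>i\<in>I. indicator {-1/2..1/2} ((x(k := t)) i)) = (\<Prod>i\<in>I. indicator {-1/2..1/2::real} (x i) :: ennreal)"
    using assms by (intro prod.cong) auto
  moreover have "(\<Sum>i\<in>I. w i * (x(k := t)) i) = (\<Sum>i\<in>I. w i * x i)"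
    using assms by (intro sum.cong) auto
  ultimately show ?thesis
    using assms by (simp add: ac_simps del: fun_upd_apply) (simp add: ac_simps)
qed

text \<open>Fubini in both orders. Integrating the new variable first smooths the test function, as
  the trapezoid and the tents require; integrating it last conditions on it, as the induction
  towards splines requires.\<close>

lemma
  assumes "finite I" "k \<notin> I" and [measurable]: "\<phi> \<in> borel_measurable borel"
  shows cube_int_insert: "cube_int (insert k I) w \<phi> =
      cube_int I w (\<lambda>z. \<integral>\<^sup>+t\<in>{-1/2..1/2}. \<phi> (w k * t + z) \<partial>lborel)"
    and cube_int_insert_rev: "cube_int (insert k I) w \<phi> =
      (\<integral>\<^sup>+t\<in>{-1/2..1/2}. cube_int I w (\<lambda>z. \<phi> (w k * t + z)) \<partial>lborel)"
proof -
  have meas: "(\<lambda>x. (\<Prod>i\<in>insert k I. indicator {-1/2..1/2} (x i)) * \<phi> (\<Sum>i\<in>insert k I. w i * x i))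
      \<in> borel_measurable (Pi\<^sub>M (insert k I) (\<lambda>_. lborel))"
    by measurable
  show "cube_int (insert k I) w \<phi> = cube_int I w (\<lambda>z. \<integral>\<^sup>+t\<in>{-1/2..1/2}. \<phi> (w k * t + z) \<partial>lborel)"
    unfolding cube_int_def lborel_PiM.product_nn_integral_insert[OF assms(1,2) meas]
      cube_int_integrand_insert[OF assms(1,2)]
    by (intro nn_integral_cong nn_integral_cmult) measurable
  show "cube_int (insert k I) w \<phi> = (\<integral>\<^sup>+t\<in>{-1/2..1/2}. cube_int I w (\<lambda>z. \<phi> (w k * t + z)) \<partial>lborel)"
    unfolding cube_int_def lborel_PiM.product_nn_integral_insert_rev[OF assms(1,2) meas]
      cube_int_integrand_insert[OF assms(1,2)]
    unfolding mult.assoc[symmetric]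
    by (intro nn_integral_cong nn_integral_multc) measurable
qed

lemma cube_int_mono: "(\<And>z. \<phi> z \<le> \<psi> z) \<Longrightarrow> cube_int I w \<phi> \<le> cube_int I w \<psi>"
  unfolding cube_int_def by (intro nn_integral_mono mult_left_mono) auto

lemma cube_int_add:
  assumes [measurable]: "\<phi> \<in> borel_measurable borel" "\<psi> \<in> borel_measurable borel"
  shows "cube_int I w (\<lambda>z. \<phi> z + \<psi> z) = cube_int I w \<phi> + cube_int I w \<psi>"
  unfolding cube_int_def distrib_left by (intro nn_integral_add) measurable

lemma cube_int_cmult:
  assumes [measurable]: "\<phi> \<in> borel_measurable borel"
  shows "cube_int I w (\<lambda>z. c * \<phi> z) = c * cube_int I w \<phi>"
  unfolding cube_int_def mult.left_commute[of _ c] by (intro nn_integral_cmult) measurable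

lemma cube_int_const:
  assumes "finite I"
  shows "cube_int I w (\<lambda>_. c) = c"
  using assms
proof induction
  case (insert k I)
  have "(\<integral>\<^sup>+t\<in>{-1/2..1/2}. c \<partial>(lborel::real measure)) = c"
    by (simp add: nn_integral_cmult_indicator)
  then show ?case using insert by (simp add: cube_int_insert)
qed (simp add: cube_int_empty)

text \<open>A coupling: both linear forms are evaluated at the same point of the cube, where each
  coordinate is at most 1/2 in absolute value, so they differ by at most
  \<open>card I * d / 2\<close>.\<close>

lemma cube_int_perturb:
  assumes "finite I" "\<And>i. i \<in> I \<Longrightarrow> \<bar>w i - w' i\<bar> \<le> d"
    and le: "\<And>z z'. \<bar>z - z'\<bar> \<le> real (card I) * d / 2 \<Longrightarrow> \<phi> z \<le> \<psi> z'"
  shows "cube_int I w \<phi> \<le> cube_int I w' \<psi>"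
  unfolding cube_int_def
proof (intro nn_integral_mono)
  fix x
  show "(\<Prod>i\<in>I. indicator {-1/2..1/2} (x i)) * \<phi> (\<Sum>i\<in>I. w i * x i)
     \<le> (\<Prod>i\<in>I. indicator {-1/2..1/2} (x i)) * \<psi> (\<Sum>i\<in>I. w' i * x i)"
  proof (cases "\<forall>i\<in>I. x i \<in> {-1/2..1/2}")
    case True
    have "\<bar>(\<Sum>i\<in>I. w i * x i) - (\<Sum>i\<in>I. w' i * x i)\<bar> = \<bar>\<Sum>i\<in>I. (w i - w' i) * x i\<bar>"
      by (simp add: sum_subtractf left_diff_distrib)
    also have "\<dots> \<le> (\<Sum>i\<in>I. \<bar>w i - w' i\<bar> * \<bar>x i\<bar>)"
      unfolding abs_mult[symmetric] by (rule sum_abs)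
    also have "\<dots> \<le> (\<Sum>i\<in>I. d * (1/2))"
    proof (intro sum_mono mult_mono)
      fix i assume "i \<in> I"
      then show "\<bar>w i - w' i\<bar> \<le> d" "\<bar>x i\<bar> \<le> 1/2" "d \<ge> 0"
        using True assms(2)[of i] by (auto simp: abs_le_iff intro: order_trans[OF abs_ge_zero])
    qed auto
    finally show ?thesis by (intro mult_left_mono le) (auto simp: field_simps)
  next
    case False
    then have "(\<Prod>i\<in>I. indicator {-1/2..1/2} (x i)) = (0::ennreal)"
      using assms(1) by (auto intro!: prod_zero simp: indicator_def)
    then show ?thesis by (simp only: mult_zero_left order_refl)
  qed
qed

text \<open>The slab of width 1 acts as one more uniform variable, so \<open>card I\<close>
  variables give the density of a sum of \<open>card I + 1\<close>, which has spline index
  \<open>card I\<close>.\<close>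

lemma cube_int_ones_eq_spline:
  assumes "finite I" "I \<noteq> {}"
  shows "cube_int I (\<lambda>_. 1) (\<lambda>z. indicator {-1/2..1/2} (z + x)) = ennreal (spline (card I) x)"
  using assms
proof (induction I arbitrary: x rule: finite_ne_induct)
  case (singleton k)
  have "cube_int {k} (\<lambda>_. 1) (\<lambda>z. indicator {-1/2..1/2} (z + x)) =
      (\<integral>\<^sup>+t. indicator ({-1/2..1/2} \<inter> {-1/2 - x..1/2 - x}) t \<partial>lborel)"
    by (subst cube_int_insert, simp, simp, measurable, unfold cube_int_empty, intro nn_integral_cong)
       (auto split: split_indicator)
  also have "\<dots> = emeasure lborel {max (-1/2) (-1/2 - x)..min (1/2) (1/2 - x)}"
    unfolding Int_atLeastAtMost by (subst nn_integral_indicator) auto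
  also have "\<dots> = ennreal (max 0 (1 - \<bar>x\<bar>))"
    unfolding emeasure_lborel_Icc_eq by (auto simp: max_def min_def abs_if field_simps)
  finally show ?case by (simp add: spline_1[unfolded One_nat_def])
next
  case (insert k I)
  have "card I \<ge> 1" using insert by (simp add: Suc_le_eq card_gt_0_iff)
  have "cube_int (insert k I) (\<lambda>_. 1) (\<lambda>z. indicator {-1/2..1/2} (z + x)) =
      (\<integral>\<^sup>+t\<in>{-1/2..1/2}. cube_int I (\<lambda>_. 1) (\<lambda>z. indicator {-1/2..1/2} (z + (x + t))) \<partial>lborel)"
    using insert.hyps by (subst cube_int_insert_rev) (auto simp: ac_simps)
  also have "\<dots> = (\<integral>\<^sup>+t\<in>{-1/2..1/2}. ennreal (spline (card I) (x + t)) \<partial>lborel)"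
    unfolding insert.IH ..
  finally show ?case
    using nn_integral_spline[OF \<open>card I \<ge> 1\<close>] insert.hyps by simp
qed

text \<open>Given the other variables, the sum is uniform on an interval of length 1, because
  \<open>w k = 1\<close>. Each of the two added strips of width c' - c thus has probability at most
  c' - c.\<close>

lemma cube_int_slab_lipschitz:
  assumes "finite I" "k \<in> I" "w k = 1" "c \<le> c'"
  shows "cube_int I w (indicator {-c'..c'}) \<le> cube_int I w (indicator {-c..c}) + ennreal (2 * (c' - c))"
proof -
  obtain J where J: "I = insert k J" "k \<notin> J" "finite J"
    using assms by (metis mk_disjoint_insert finite_insert)
  have len: "(\<integral>\<^sup>+t\<in>{-1/2..1/2}. indicator {a..b} (t + z) \<partial>lborel) \<le> ennreal (b - a)" if "a \<le> b" for a b z :: real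
  proof -
    have "(\<integral>\<^sup>+t\<in>{-1/2..1/2}. indicator {a..b} (t + z) \<partial>lborel) \<le> (\<integral>\<^sup>+t. indicator {a - z..b - z} t \<partial>lborel)"
      by (intro nn_integral_mono) (auto simp: indicator_def)
    also have "\<dots> = ennreal (b - a)" using that by simp
    finally show ?thesis .
  qed
  have "(\<integral>\<^sup>+t\<in>{-1/2..1/2}. indicator {-c'..c'} (t + z) \<partial>lborel) \<le>
      (\<integral>\<^sup>+t\<in>{-1/2..1/2}. indicator {-c..c} (t + z) \<partial>lborel) + ennreal (2 * (c' - c))" for z
  proof -
    have "(\<integral>\<^sup>+t\<in>{-1/2..1/2}. indicator {-c'..c'} (t + z) \<partial>lborel) \<le>
      (\<integral>\<^sup>+t\<in>{-1/2..1/2}. indicator {-c..c} (t + z) + (indicator {-c'..-c} (t + z) + indicator {c..c'} (t + z)) \<partial>lborel)"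
      by (intro nn_integral_mono) (auto simp: indicator_def)
    also have "\<dots> = (\<integral>\<^sup>+t\<in>{-1/2..1/2}. indicator {-c..c} (t + z) \<partial>lborel) +
       ((\<integral>\<^sup>+t\<in>{-1/2..1/2}. indicator {-c'..-c} (t + z) \<partial>lborel) + (\<integral>\<^sup>+t\<in>{-1/2..1/2}. indicator {c..c'} (t + z) \<partial>lborel))"
      unfolding distrib_right by (subst nn_integral_add; (subst nn_integral_add)?) auto
    also have "\<dots> \<le> (\<integral>\<^sup>+t\<in>{-1/2..1/2}. indicator {-c..c} (t + z) \<partial>lborel) + (ennreal (- c - - c') + ennreal (c' - c))"
      using assms by (intro add_left_mono add_mono len) auto
    also have "ennreal (- c - - c') + ennreal (c' - c) = ennreal (2 * (c' - c))"
      using assms by (subst ennreal_plus[symmetric]) auto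
    finally show ?thesis .
  qed
  then have "cube_int J w (\<lambda>z. \<integral>\<^sup>+t\<in>{-1/2..1/2}. indicator {-c'..c'} (t + z) \<partial>lborel) \<le>
     cube_int J w (\<lambda>z. (\<integral>\<^sup>+t\<in>{-1/2..1/2}. indicator {-c..c} (t + z) \<partial>lborel) + ennreal (2 * (c' - c)))"
    by (rule cube_int_mono)
  also have "\<dots> = cube_int J w (\<lambda>z. \<integral>\<^sup>+t\<in>{-1/2..1/2}. indicator {-c..c} (t + z) \<partial>lborel) + ennreal (2 * (c' - c))"
    by (subst cube_int_add) (simp_all add: cube_int_const J)
  finally show ?thesis
    unfolding J(1) using J assms(3) by (simp add: cube_int_insert)
qed

section \<open>Tents and their means\<close>

definition tent :: "real \<Rightarrow> real \<Rightarrow> real" where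
  "tent c z = max 0 (c - \<bar>z\<bar>)"

lemma tent_nonneg [simp]: "tent c z \<ge> 0"
  by (simp add: tent_def)

lemma tent_mono: "c \<le> c' \<Longrightarrow> tent c z \<le> tent c' z"
  by (simp add: tent_def)

lemma tent_measurable [measurable]: "tent c \<in> borel_measurable borel"
  unfolding tent_def[abs_def] by measurable

text \<open>The convolution of the indicators of two centred intervals is a trapezoid, that is, a
  difference of two tents.\<close>

lemma nn_integral_slab_section:
  assumes "a > 0" "b > 0"
  shows "(\<integral>\<^sup>+t\<in>{-1/2..1/2}. indicator {-b/2..b/2} (a * t + z) \<partial>lborel) =
    ennreal ((tent ((a + b) / 2) z - tent (\<bar>a - b\<bar> / 2) z) / a)"
proof -
  define l where "l = max (-1/2) ((-b/2 - z) / a)"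
  define u where "u = min (1/2) ((b/2 - z) / a)"
  have "(\<integral>\<^sup>+t\<in>{-1/2..1/2}. indicator {-b/2..b/2} (a * t + z) \<partial>lborel) = (\<integral>\<^sup>+t. indicator {l..u} t \<partial>lborel)"
  proof (intro nn_integral_cong)
    fix t
    have "a * t + z \<in> {-b/2..b/2} \<longleftrightarrow> t \<in> {(-b/2 - z) / a..(b/2 - z) / a}"
      using assms by (auto simp: field_simps)
    then show "indicator {-b/2..b/2} (a * t + z) * indicator {-1/2..1/2} t = (indicator {l..u} t :: ennreal)"
      by (auto simp: indicator_def l_def u_def)
  qed
  also have "\<dots> = ennreal (max 0 (u - l))" by (simp add: max_def)
  also have "max 0 (u - l) = (tent ((a + b) / 2) z - tent (\<bar>a - b\<bar> / 2) z) / a"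
  proof -
    have "a * l = max (-a/2) (-b/2 - z)" "a * u = min (a/2) (b/2 - z)"
      using assms by (simp_all add: l_def u_def max_mult_distrib_left min_mult_distrib_left)
    moreover have "a * max 0 (u - l) = max 0 (a * u - a * l)"
      using assms by (simp add: max_mult_distrib_left right_diff_distrib)
    moreover have "max 0 (min (a/2) (b/2 - z) - max (-a/2) (-b/2 - z)) =
        tent ((a + b) / 2) z - tent (\<bar>a - b\<bar> / 2) z"
      unfolding tent_def max_def min_def abs_if using assms by (auto simp: field_simps)
    ultimately show ?thesis using assms by (simp add: field_simps)
  qed
  finally show ?thesis .
qed

text \<open>The third hypothesis says that the interval swept by \<open>a * t + z\<close> contains
  the whole support of the tent. The integral is then the area c^2 of the tent divided by the speed
  a, whatever z is.\<close>

lemma nn_integral_tent: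
  assumes "a > 0" "c \<ge> 0" "\<bar>z\<bar> + c \<le> a / 2"
  shows "(\<integral>\<^sup>+t\<in>{-1/2..1/2}. ennreal (tent c (a * t + z)) \<partial>lborel) = ennreal (c\<^sup>2 / a)"
proof -
  \<comment> \<open>The tent is a second difference of the positive part, and \<open>G\<close> is
    the same difference of an antiderivative. Writing \<open>y + 0\<close> and
    \<open>y + - c\<close> lets \<open>sq\<close> apply to all three terms.\<close>
  define G where "G y = ((max 0 (y + c))\<^sup>2 - 2 * (max 0 (y + 0))\<^sup>2 + (max 0 (y + - c))\<^sup>2) / 2" for y
  have sq: "((\<lambda>y. (max 0 (y + s))\<^sup>2) has_real_derivative 2 * max 0 (y + s)) (at y)" for s y
  proof -
    have "((\<lambda>y. (max 0 (y + s))^Suc 1) has_real_derivative real (Suc 1) * (max 0 (y + s))^1 * 1) (at y)"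
      by (rule DERIV_chain2[where f = "\<lambda>y. (max 0 y)^Suc 1", OF max_0_power_has_real_derivative])
         (auto intro!: derivative_eq_intros)
    then show ?thesis by (simp add: numeral_2_eq_2)
  qed
  have G: "(G has_real_derivative tent c y) (at y)" for y
  proof -
    have "(G has_real_derivative (2 * max 0 (y + c) - 2 * (2 * max 0 (y + 0)) + 2 * max 0 (y + - c)) / 2) (at y)"
      unfolding G_def by (intro DERIV_cdivide DERIV_add DERIV_diff DERIV_cmult sq)
    moreover have "(2 * max 0 (y + c) - 2 * (2 * max 0 (y + 0)) + 2 * max 0 (y + - c)) / 2 = tent c y"
      using assms(2) by (auto simp: tent_def max_def abs_if)
    ultimately show ?thesis by simp
  qed
  have deriv: "((\<lambda>t. G (a * t + z) / a) has_real_derivative tent c (a * t + z)) (at t)" for t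
  proof -
    have "((\<lambda>t. G (a * t + z) / a) has_real_derivative (tent c (a * t + z) * a) / a) (at t)"
      by (intro DERIV_cdivide DERIV_chain2[OF G]) (auto intro!: derivative_eq_intros)
    then show ?thesis using assms(1) by simp
  qed
  have "(\<integral>\<^sup>+t\<in>{-1/2..1/2}. ennreal (tent c (a * t + z)) \<partial>lborel) =
    ennreal (G (a * (1/2) + z) / a - G (a * (-1/2) + z) / a)"
    by (intro nn_integral_FTC_Icc) (auto intro!: has_field_derivative_at_within deriv)
  also have "G (a * (1/2) + z) = c\<^sup>2"
    using assms by (auto simp: G_def max_def power2_eq_square field_simps abs_if split: if_splits)
  also have "G (a * (-1/2) + z) = 0"
    using assms by (auto simp: G_def max_def power2_eq_square field_simps abs_if split: if_splits)
  finally show ?thesis by simp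
qed

text \<open>Integrate out the variable k. Where both tents fit into the swept interval, the gain is
  exactly the difference of their areas over \<open>w k\<close>; elsewhere monotonicity suffices.
  This bound takes the place of a second derivative.\<close>

lemma cube_int_tent_gain:
  assumes "finite I" "k \<notin> I" "w k > 0" "0 \<le> c" "c \<le> c'"
  shows "cube_int (insert k I) w (\<lambda>z. ennreal (tent c z)) +
      ennreal ((c'\<^sup>2 - c\<^sup>2) / w k) * cube_int I w (indicator {-(w k / 2 - c')..w k / 2 - c'})
    \<le> cube_int (insert k I) w (\<lambda>z. ennreal (tent c' z))"
proof -
  define \<theta> where "\<theta> c z = (\<integral>\<^sup>+t\<in>{-1/2..1/2}. ennreal (tent c (w k * t + z)) \<partial>lborel)" for c z
  have [measurable]: "\<theta> c \<in> borel_measurable borel" for c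
    unfolding \<theta>_def[abs_def] by measurable
  have "\<theta> c z + ennreal ((c'\<^sup>2 - c\<^sup>2) / w k) * indicator {-(w k / 2 - c')..w k / 2 - c'} z \<le> \<theta> c' z" for z
  proof (cases "\<bar>z\<bar> \<le> w k / 2 - c'")
    case True
    have "\<theta> c z = ennreal (c\<^sup>2 / w k)" "\<theta> c' z = ennreal (c'\<^sup>2 / w k)"
      unfolding \<theta>_def using True assms by (intro nn_integral_tent; simp)+
    moreover have "c\<^sup>2 \<le> c'\<^sup>2" using assms by (intro power_mono)
    ultimately show ?thesis
      using True assms by (simp add: ennreal_plus[symmetric] diff_divide_distrib abs_le_iff divide_right_mono del: ennreal_plus)
  next
    case False
    have "\<theta> c z \<le> \<theta> c' z"
      unfolding \<theta>_def using assms by (intro nn_integral_mono mult_right_mono ennreal_leI tent_mono) auto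
    then show ?thesis using False by (auto simp: indicator_def abs_le_iff)
  qed
  then have "cube_int I w (\<lambda>z. \<theta> c z + ennreal ((c'\<^sup>2 - c\<^sup>2) / w k) * indicator {-(w k / 2 - c')..w k / 2 - c'} z)
     \<le> cube_int I w (\<theta> c')"
    by (rule cube_int_mono)
  moreover have "cube_int (insert k I) w (\<lambda>z. ennreal (tent c z)) = cube_int I w (\<theta> c)" for c
    using assms(1,2) by (simp add: cube_int_insert \<theta>_def[abs_def])
  ultimately show ?thesis
    by (simp add: cube_int_add cube_int_cmult)
qed

section \<open>The volume of a central section\<close>

lemma emeasure_lborel_translate_vimage:
  fixes c :: real
  assumes "A \<in> sets borel"
  shows "emeasure lborel ((\<lambda>t. t + c) -` A) = emeasure lborel A"
proof -
  have "emeasure lborel A = emeasure (distr lborel borel ((+) c)) A"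
    by (simp only: lborel_distr_plus)
  also have "\<dots> = emeasure lborel ((\<lambda>t. t + c) -` A)"
    using assms by (subst emeasure_distr) (auto intro!: arg_cong2[where f = emeasure] simp: add.commute)
  finally show ?thesis ..
qed

text \<open>Relabelling and translation in one statement: with \<beta> the identity it gives
  translation invariance, with c = 0 the exchange of two bases of equal size.\<close>

lemma distr_PiM_lborel_affine:
  fixes c :: "'j \<Rightarrow> real"
  assumes "finite J" "bij_betw \<beta> J I"
  shows "distr (Pi\<^sub>M I (\<lambda>_. lborel)) (Pi\<^sub>M J (\<lambda>_. lborel)) (\<lambda>f. \<lambda>j\<in>J. f (\<beta> j) + c j) = Pi\<^sub>M J (\<lambda>_. lborel)"
proof (rule lborel_PiM.PiM_eqI)
  have I: "finite I" "\<And>j. j \<in> J \<Longrightarrow> \<beta> j \<in> I"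
    using assms bij_betw_finite bij_betwE by blast+
  have [measurable]: "(\<lambda>f. \<lambda>j\<in>J. f (\<beta> j) + c j) \<in> Pi\<^sub>M I (\<lambda>_. lborel) \<rightarrow>\<^sub>M Pi\<^sub>M J (\<lambda>_. lborel)"
    using I by (intro measurable_restrict) measurable
  fix A :: "'j \<Rightarrow> real set"
  assume A: "\<And>j. j \<in> J \<Longrightarrow> A j \<in> sets lborel"
  define \<gamma> where "\<gamma> = the_inv_into J \<beta>"
  have \<gamma>: "\<gamma> (\<beta> j) = j" if "j \<in> J" for j
    using that assms(2) unfolding \<gamma>_def by (simp add: bij_betw_def the_inv_into_f_f)
  define D where "D i = (\<lambda>t. t + c (\<gamma> i)) -` A (\<gamma> i)" for i
  have D: "D i \<in> sets lborel" "emeasure lborel (D i) = emeasure lborel (A (\<gamma> i))" if "i \<in> I" for i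
  proof -
    have "\<gamma> i \<in> J" using that assms(2) bij_betw_the_inv_into[OF assms(2)] bij_betwE unfolding \<gamma>_def by blast
    then have "A (\<gamma> i) \<in> sets borel" using A by simp
    then show "D i \<in> sets lborel" "emeasure lborel (D i) = emeasure lborel (A (\<gamma> i))"
      unfolding D_def using measurable_sets_borel[of "\<lambda>t. t + c (\<gamma> i)" borel "A (\<gamma> i)"]
      by (auto simp: emeasure_lborel_translate_vimage)
  qed
  have "(\<lambda>f. \<lambda>j\<in>J. f (\<beta> j) + c j) -` Pi\<^sub>E J A \<inter> space (Pi\<^sub>M I (\<lambda>_. lborel)) = Pi\<^sub>E I D"
    using assms(2) I(2) \<gamma> unfolding D_def bij_betw_def
    by (auto simp: space_PiM PiE_iff)
  then have "emeasure (distr (Pi\<^sub>M I (\<lambda>_. lborel)) (Pi\<^sub>M J (\<lambda>_. lborel)) (\<lambda>f. \<lambda>j\<in>J. f (\<beta> j) + c j)) (Pi\<^sub>E J A)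
      = emeasure (Pi\<^sub>M I (\<lambda>_. lborel)) (Pi\<^sub>E I D)"
    using A assms(1) by (subst emeasure_distr) (auto intro!: sets_PiM_I_finite)
  also have "\<dots> = (\<Prod>i\<in>I. emeasure lborel (A (\<gamma> i)))"
    using I(1) D by (subst lborel_PiM.emeasure_PiM) auto
  also have "\<dots> = (\<Prod>j\<in>J. emeasure lborel (A j))"
    using \<gamma> by (subst prod.reindex_bij_betw[OF assms(2), symmetric]) simp
  finally show "emeasure (distr (Pi\<^sub>M I (\<lambda>_. lborel)) (Pi\<^sub>M J (\<lambda>_. lborel)) (\<lambda>f. \<lambda>j\<in>J. f (\<beta> j) + c j)) (Pi\<^sub>E J A)
      = (\<Prod>j\<in>J. emeasure lborel (A j))" .
qed (use assms in auto)

section \<open>Lebesgue measure in orthonormal coordinates\<close>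

definition coords_comb :: "'a::euclidean_space set \<Rightarrow> ('a \<Rightarrow> real) \<Rightarrow> 'a" where
  "coords_comb B f = (\<Sum>b\<in>B. f b *\<^sub>R b)"

lemma coords_comb_measurable [measurable]:
  "coords_comb B \<in> borel_measurable (Pi\<^sub>M B (\<lambda>_. lborel))"
  unfolding coords_comb_def[abs_def] by measurable

definition orthonormal_set :: "'a::euclidean_space set \<Rightarrow> bool" where
  "orthonormal_set B \<longleftrightarrow> pairwise orthogonal B \<and> (\<forall>b\<in>B. norm b = 1)"

lemma orthonormal_set_independent: "orthonormal_set B \<Longrightarrow> independent B"
  unfolding orthonormal_set_def by (intro pairwise_orthogonal_independent) auto

lemma orthonormal_set_finite: "orthonormal_set B \<Longrightarrow> finite B"
  using orthonormal_set_independent independent_imp_finite by blast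

lemma orthonormal_set_inner:
  assumes "orthonormal_set B" "b \<in> B" "b' \<in> B"
  shows "b \<bullet> b' = (if b = b' then 1 else 0)"
  using assms unfolding orthonormal_set_def pairwise_def orthogonal_def
  by (auto simp: norm_eq_1)

lemma norm_coords_comb:
  assumes "orthonormal_set B"
  shows "(norm (coords_comb B f))\<^sup>2 = (\<Sum>b\<in>B. (f b)\<^sup>2)"
proof -
  have "(norm (coords_comb B f))\<^sup>2 = (\<Sum>b\<in>B. (norm (f b *\<^sub>R b))\<^sup>2)"
    unfolding coords_comb_def using assms orthonormal_set_finite[OF assms]
    by (intro norm_sum_Pythagorean) (auto simp: orthonormal_set_def pairwise_def orthogonal_def)
  also have "\<dots> = (\<Sum>b\<in>B. (f b)\<^sup>2)"
    using assms by (intro sum.cong) (auto simp: orthonormal_set_def)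
  finally show ?thesis .
qed

lemma coords_comb_inner:
  assumes "orthonormal_set B" "x \<in> span B"
  shows "coords_comb B (\<lambda>b. x \<bullet> b) = x"
proof -
  have fin: "finite B" using assms(1) by (rule orthonormal_set_finite)
  obtain g where g: "x = (\<Sum>b\<in>B. g b *\<^sub>R b)"
    using assms(2) unfolding span_finite[OF fin] by auto
  have "x \<bullet> b = g b" if "b \<in> B" for b
  proof -
    have "x \<bullet> b = (\<Sum>b'\<in>B. g b' * (b' \<bullet> b))"
      unfolding g by (simp add: inner_sum_left)
    also have "\<dots> = (\<Sum>b'\<in>B. if b' = b then g b else 0)"
      using that assms(1) by (intro sum.cong) (auto simp: orthonormal_set_inner)
    finally show ?thesis using fin that by simp
  qed
  then show ?thesis
    unfolding coords_comb_def by (subst (2) g) (auto intro!: sum.cong)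
qed

text \<open>Adding y shifts the coordinate at b by y \<bullet> b, because y lies in the span. This
  serves both the uniqueness argument and the comparison of parallel slices.\<close>

lemma nn_integral_coords_comb_translate:
  assumes "orthonormal_set B" "y \<in> span B" and [measurable]: "g \<in> borel_measurable borel"
  shows "(\<integral>\<^sup>+f. g (coords_comb B f + y) \<partial>Pi\<^sub>M B (\<lambda>_. lborel)) = (\<integral>\<^sup>+f. g (coords_comb B f) \<partial>Pi\<^sub>M B (\<lambda>_. lborel))"
proof -
  have fin: "finite B" using assms(1) by (rule orthonormal_set_finite)
  have shift: "coords_comb B (\<lambda>b\<in>B. f (id b) + y \<bullet> b) = coords_comb B f + y" for f
  proof -
    have "coords_comb B (\<lambda>b\<in>B. f (id b) + y \<bullet> b) = coords_comb B f + coords_comb B (\<lambda>b. y \<bullet> b)"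
      unfolding coords_comb_def by (simp add: sum.distrib scaleR_add_left)
    then show ?thesis using coords_comb_inner[OF assms(1,2)] by simp
  qed
  have [measurable]: "(\<lambda>f. \<lambda>b\<in>B. f (id b) + y \<bullet> b) \<in> Pi\<^sub>M B (\<lambda>_. lborel) \<rightarrow>\<^sub>M Pi\<^sub>M B (\<lambda>_. lborel :: real measure)"
    by (intro measurable_restrict) measurable
  have "(\<integral>\<^sup>+f. g (coords_comb B f) \<partial>Pi\<^sub>M B (\<lambda>_. lborel)) =
    (\<integral>\<^sup>+f. g (coords_comb B f) \<partial>distr (Pi\<^sub>M B (\<lambda>_. lborel)) (Pi\<^sub>M B (\<lambda>_. lborel)) (\<lambda>f. \<lambda>b\<in>B. f (id b) + y \<bullet> b))"
    using distr_PiM_lborel_affine[OF fin bij_betw_id, of "\<lambda>b. y \<bullet> b"] by simp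
  also have "\<dots> = (\<integral>\<^sup>+f. g (coords_comb B f + y) \<partial>Pi\<^sub>M B (\<lambda>_. lborel))"
    by (subst nn_integral_distr) (simp_all only: shift, measurable)
  finally show ?thesis ..
qed

text \<open>Membership in a centred ball depends only on the sum of squared coordinates, so any
  bijection between the bases carries one integral to the other. That makes the ball the right set
  for fixing the constant below.\<close>

lemma emeasure_coords_comb_ball_eq:
  fixes B C :: "'a::euclidean_space set"
  assumes "orthonormal_set B" "orthonormal_set C" "card B = card C"
  shows "(\<integral>\<^sup>+f. indicator (ball 0 1) (coords_comb B f) \<partial>Pi\<^sub>M B (\<lambda>_. lborel)) =
         (\<integral>\<^sup>+f. indicator (ball 0 1) (coords_comb C f) \<partial>Pi\<^sub>M C (\<lambda>_. lborel))"
proof -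
  have fin: "finite B" "finite C" using assms orthonormal_set_finite by auto
  then obtain \<beta> where \<beta>: "bij_betw \<beta> B C"
    using assms(3) finite_same_card_bij by blast
  have F [measurable]: "ball (0::'a) 1 \<in> sets borel" by simp
  have T: "(\<lambda>f. \<lambda>b\<in>B. f (\<beta> b) + 0) \<in> Pi\<^sub>M C (\<lambda>_. lborel) \<rightarrow>\<^sub>M Pi\<^sub>M B (\<lambda>_. lborel :: real measure)"
    using bij_betwE[OF \<beta>] by (intro measurable_restrict) measurable
  have norm_eq: "(norm (coords_comb B (\<lambda>b\<in>B. f (\<beta> b) + 0)))\<^sup>2 = (norm (coords_comb C f))\<^sup>2" for f
    unfolding norm_coords_comb[OF assms(1)] norm_coords_comb[OF assms(2)]
    by (subst sum.reindex_bij_betw[OF \<beta>, symmetric]) simp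
  then have ind_eq: "indicator (ball 0 1) (coords_comb B (\<lambda>b\<in>B. f (\<beta> b) + 0)) =
      (indicator (ball 0 1) (coords_comb C f) :: ennreal)" for f
    using norm_eq[of f] unfolding power2_eq_iff_nonneg[OF norm_ge_zero norm_ge_zero] by (simp add: indicator_def)
  have "(\<integral>\<^sup>+f. indicator (ball 0 1) (coords_comb B f) \<partial>Pi\<^sub>M B (\<lambda>_. lborel)) =
    (\<integral>\<^sup>+f. indicator (ball 0 1) (coords_comb B f) \<partial>distr (Pi\<^sub>M C (\<lambda>_. lborel)) (Pi\<^sub>M B (\<lambda>_. lborel)) (\<lambda>f. \<lambda>b\<in>B. f (\<beta> b) + 0))"
    by (subst distr_PiM_lborel_affine[OF fin(1) \<beta>]) simp
  also have "\<dots> = (\<integral>\<^sup>+f. indicator (ball 0 1) (coords_comb C f) \<partial>Pi\<^sub>M C (\<lambda>_. lborel))"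
    using F by (subst nn_integral_distr[OF T]) (simp_all only: ind_eq, measurable)
  finally show ?thesis .
qed

lemma orthonormal_set_Basis: "orthonormal_set Basis"
  unfolding orthonormal_set_def by (auto simp: pairwise_def orthogonal_def inner_not_same_Basis)

lemma nn_integral_lborel_coords:
  fixes g :: "'a::euclidean_space \<Rightarrow> ennreal"
  assumes [measurable]: "g \<in> borel_measurable borel"
  shows "(\<integral>\<^sup>+x. g x \<partial>lborel) = (\<integral>\<^sup>+f. g (coords_comb Basis f) \<partial>Pi\<^sub>M Basis (\<lambda>_. lborel))"
  unfolding coords_comb_def by (subst lborel_eq) (rule nn_integral_distr; measurable)

lemma emeasure_lborel_reflect:
  fixes x :: "'a::euclidean_space"
  assumes [measurable]: "E \<in> sets borel"
  shows "(\<integral>\<^sup>+y. indicator E (x - y) \<partial>lborel) = emeasure lborel E"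
proof -
  have "emeasure lborel E = emeasure (density (distr lborel borel (\<lambda>y. x + (-1) *\<^sub>R y)) (\<lambda>_. 1)) E"
    by (subst lborel_affine[of "-1" x]) auto
  also have "density (distr lborel borel (\<lambda>y. x + (-1) *\<^sub>R y)) (\<lambda>_. 1) = distr lborel borel (\<lambda>y. x - y)"
    by (simp add: density_1)
  also have "emeasure \<dots> E = (\<integral>\<^sup>+y. indicator E y \<partial>distr lborel borel (\<lambda>y. x - y))"
    by (subst nn_integral_indicator) auto
  also have "\<dots> = (\<integral>\<^sup>+y. indicator E (x - y) \<partial>lborel)"
    by (subst nn_integral_distr) auto
  finally show ?thesis ..
qed

text \<open>Uniqueness of translation invariant measures, by evaluating the double integral of
  1_E (x) 1_F (x + y), x with respect to one measure and y with respect to the other, in both orders.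
  The constant is found with F the unit ball.\<close>

lemma emeasure_lborel_orthonormal:
  fixes B :: "'a::euclidean_space set"
  assumes B: "orthonormal_set B" "card B = DIM('a)" and [measurable]: "E \<in> sets borel"
  shows "emeasure lborel E = (\<integral>\<^sup>+f. indicator E (coords_comb B f) \<partial>Pi\<^sub>M B (\<lambda>_. lborel))"
proof -
  let ?P = "Pi\<^sub>M B (\<lambda>_. lborel :: real measure)"
  let ?F = "ball (0::'a) 1"
  define \<kappa> where "\<kappa> = emeasure lborel ?F"
  have [measurable]: "?F \<in> sets borel" by simp
  have fin: "finite B" using B(1) by (rule orthonormal_set_finite)
  have span: "x \<in> span B" for x
  proof -
    have "UNIV \<subseteq> span B"
      using B by (intro card_ge_dim_independent orthonormal_set_independent) auto
    then show ?thesis by blast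
  qed
  interpret P: sigma_finite_measure ?P by (rule lborel_PiM.sigma_finite[OF fin])
  interpret pair_sigma_finite ?P "lborel :: 'a measure" by standard
  have \<kappa>: "\<kappa> \<noteq> 0" "\<kappa> \<noteq> \<infinity>"
    unfolding \<kappa>_def using emeasure_lborel_ball_finite[of "0::'a" 1] open_not_negligible[of ?F]
    by (auto simp: negligible_iff_emeasure0)
  have ball: "(\<integral>\<^sup>+f. indicator ?F (coords_comb B f) \<partial>?P) = \<kappa>"
  proof -
    have "(\<integral>\<^sup>+f. indicator ?F (coords_comb B f) \<partial>?P) = (\<integral>\<^sup>+f. indicator ?F (coords_comb Basis f) \<partial>Pi\<^sub>M Basis (\<lambda>_. lborel))"
      using B by (intro emeasure_coords_comb_ball_eq orthonormal_set_Basis) auto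
    also have "\<dots> = (\<integral>\<^sup>+x. indicator ?F x \<partial>lborel)"
      by (subst nn_integral_lborel_coords; measurable)
    finally show ?thesis by (simp add: \<kappa>_def)
  qed
  have "(\<integral>\<^sup>+f. indicator E (coords_comb B f) \<partial>?P) * \<kappa> = (\<integral>\<^sup>+f. indicator E (coords_comb B f) * \<kappa> \<partial>?P)"
    by (rule nn_integral_multc[symmetric]) measurable
  also have "\<dots> = (\<integral>\<^sup>+f. \<integral>\<^sup>+y. indicator E (coords_comb B f) * indicator ?F (coords_comb B f + y) \<partial>lborel \<partial>?P)"
  proof (intro nn_integral_cong)
    fix f
    have "(\<integral>\<^sup>+y. indicator ?F (coords_comb B f + y) \<partial>lborel) = \<kappa>"
    proof -
      \<comment> \<open>The ball is symmetric about 0, which turns the sum into the difference that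
        \<open>emeasure_lborel_reflect\<close> handles.\<close>
      have "(indicator ?F (coords_comb B f + y) :: ennreal) = indicator ?F (- coords_comb B f - y)" for y
        by (simp add: indicator_def norm_minus_commute add.commute)
      then show ?thesis unfolding \<kappa>_def by (simp add: emeasure_lborel_reflect)
    qed
    moreover have "(\<lambda>y. indicator ?F (coords_comb B f + y) :: ennreal) \<in> borel_measurable lborel"
      by measurable
    ultimately show "indicator E (coords_comb B f) * \<kappa> =
        (\<integral>\<^sup>+y. indicator E (coords_comb B f) * indicator ?F (coords_comb B f + y) \<partial>lborel)"
      by (simp only: nn_integral_cmult)
  qed
  also have "\<dots> = (\<integral>\<^sup>+y. \<integral>\<^sup>+f. indicator E (coords_comb B f) * indicator ?F (coords_comb B f + y) \<partial>?P \<partial>lborel)"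
    by (rule Fubini'[symmetric]) measurable
  also have "\<dots> = (\<integral>\<^sup>+y. \<integral>\<^sup>+f. indicator E (coords_comb B f - y) * indicator ?F (coords_comb B f) \<partial>?P \<partial>lborel)"
  proof (rule nn_integral_cong)
    fix y :: 'a
    have "(\<integral>\<^sup>+f. indicator E (coords_comb B f + y - y) * indicator ?F (coords_comb B f + y) \<partial>?P) =
       (\<integral>\<^sup>+f. indicator E (coords_comb B f - y) * indicator ?F (coords_comb B f) \<partial>?P)"
      by (rule nn_integral_coords_comb_translate[OF B(1) span,
            where g = "\<lambda>x. indicator E (x - y) * indicator ?F x"]) measurable
    then show "(\<integral>\<^sup>+f. indicator E (coords_comb B f) * indicator ?F (coords_comb B f + y) \<partial>?P) =
       (\<integral>\<^sup>+f. indicator E (coords_comb B f - y) * indicator ?F (coords_comb B f) \<partial>?P)"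
      by simp
  qed
  also have "\<dots> = (\<integral>\<^sup>+f. \<integral>\<^sup>+y. indicator E (coords_comb B f - y) * indicator ?F (coords_comb B f) \<partial>lborel \<partial>?P)"
    by (rule Fubini') measurable
  also have "\<dots> = (\<integral>\<^sup>+f. emeasure lborel E * indicator ?F (coords_comb B f) \<partial>?P)"
    by (intro nn_integral_cong) (subst nn_integral_multc, simp_all add: emeasure_lborel_reflect)
  also have "\<dots> = emeasure lborel E * \<kappa>"
    by (subst nn_integral_cmult) (simp_all only: ball, measurable)
  finally show ?thesis
    using \<kappa> by (simp add: ennreal_mult_cancel_left mult.commute[of _ \<kappa>])
qed

section \<open>Sections as slab probabilities in one variable less\<close>

lemma closed_centered_cube_section:
  fixes v :: "'a::euclidean_space"
  shows "closed ({x. \<forall>b\<in>Basis. \<bar>x \<bullet> b\<bar> \<le> 1/2} \<inter> {x. v \<bullet> x = 0})"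
  unfolding Ball_def
  by (intro closed_Int closed_Collect_all closed_Collect_imp open_Collect_const closed_Collect_le
      closed_Collect_eq continuous_intros)

lemma abs_affine_le_iff:
  fixes a s t r :: real
  assumes "a > 0"
  shows "\<bar>a * t + s\<bar> \<le> r \<longleftrightarrow> t \<in> {(- r - s) / a..(r - s) / a}"
  using assms by (simp add: pos_divide_le_eq pos_le_divide_eq mult.commute) linarith

lemma coords_comb_Basis_inner: "b \<in> Basis \<Longrightarrow> coords_comb Basis f \<bullet> b = f b"
  unfolding coords_comb_def by simp

text \<open>The volume of the set W, obtained by sliding the section along the coordinate axis e, is
  computed twice: in the standard coordinates, and in coordinates adapted to the hyperplane, where its
  slices parallel to the hyperplane are translates of the section.\<close>

lemma emeasure_section_eq_cube_int:
  fixes v e :: "'a::euclidean_space" and B :: "'a set"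
  assumes e: "e \<in> Basis" and ve: "v \<bullet> e > 0"
    and B: "orthonormal_set B" "span B = {x. v \<bullet> x = 0}"
  shows "(\<integral>\<^sup>+f. indicator ({x. \<forall>b\<in>Basis. \<bar>x \<bullet> b\<bar> \<le> 1/2} \<inter> {x. v \<bullet> x = 0}) (coords_comb B f) \<partial>Pi\<^sub>M B (\<lambda>_. lborel))
      * ennreal (v \<bullet> e / norm v)
    = cube_int (Basis - {e}) (\<lambda>b. v \<bullet> b) (indicator {- (v \<bullet> e) / 2..(v \<bullet> e) / 2})"
proof -
  define I :: "'a set" where "I = Basis - {e}"
  have I: "finite I" "e \<notin> I" "insert e I = Basis" using e by (auto simp: I_def)
  define K where "K = {x. \<forall>b\<in>Basis. \<bar>x \<bullet> b\<bar> \<le> 1/2} \<inter> {x. v \<bullet> x = 0}"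
  \<comment> \<open>\<open>W\<close> is the section swept along the segment from -e/2 to e/2. The
    second condition says that the point of the hyperplane reached from x along e has e-coordinate
    at most 1/2 in absolute value, the third that its distance from x is at most 1/2.\<close>
  define W where "W = {x. (\<forall>b\<in>I. \<bar>x \<bullet> b\<bar> \<le> 1/2) \<and> \<bar>\<Sum>b\<in>I. (v \<bullet> b) * (x \<bullet> b)\<bar> \<le> (v \<bullet> e) / 2
     \<and> \<bar>v \<bullet> x\<bar> \<le> (v \<bullet> e) / 2}"
  have inner_split: "v \<bullet> x = (v \<bullet> e) * (x \<bullet> e) + (\<Sum>b\<in>I. (v \<bullet> b) * (x \<bullet> b))" for x
    using euclidean_inner[of v x] unfolding I(3)[symmetric] using I(1,2) by simp
  have K_closed: "closed K"
    unfolding K_def by (rule closed_centered_cube_section)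
  have W_closed: "closed W"
    unfolding W_def Ball_def by (intro closed_Collect_conj closed_Collect_all closed_Collect_imp open_Collect_const closed_Collect_le continuous_intros)
  have [measurable]: "K \<in> sets borel" "W \<in> sets borel"
    using K_closed W_closed by auto
  have v0: "v \<noteq> 0" using ve by auto
  then have nv: "norm v > 0" by simp

  have "emeasure lborel W = (\<integral>\<^sup>+f. indicator W (coords_comb Basis f) \<partial>Pi\<^sub>M Basis (\<lambda>_. lborel))"
    by (subst nn_integral_lborel_coords[symmetric]) auto
  also have "\<dots> = (\<integral>\<^sup>+x. \<integral>\<^sup>+t. indicator W (coords_comb Basis (x(e := t))) \<partial>lborel \<partial>Pi\<^sub>M I (\<lambda>_. lborel))"
    unfolding I(3)[symmetric]
    by (rule lborel_PiM.product_nn_integral_insert) (use I in measurable)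
  also have "\<dots> = cube_int I (\<lambda>b. v \<bullet> b) (indicator {- (v \<bullet> e) / 2..(v \<bullet> e) / 2})"
    unfolding cube_int_def
  proof (intro nn_integral_cong)
    fix x :: "'a \<Rightarrow> real"
    define s where "s = (\<Sum>b\<in>I. (v \<bullet> b) * x b)"
    define P where "P = (\<Prod>b\<in>I. indicator {-1/2..1/2} (x b) :: ennreal)"
    have P: "P = of_bool (\<forall>b\<in>I. \<bar>x b\<bar> \<le> 1/2)"
    proof (cases "\<forall>b\<in>I. \<bar>x b\<bar> \<le> 1/2")
      case True
      then have "P = 1"
        unfolding P_def by (intro prod.neutral) (fastforce simp: indicator_def abs_le_iff)
      then show ?thesis using True by simp
    next
      case False
      then have "\<exists>b\<in>I. indicator {-1/2..1/2} (x b) = (0::ennreal)"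
        by (fastforce simp: indicator_def abs_le_iff)
      then have "P = 0" unfolding P_def using I(1) by (rule prod_zero[rotated])
      then show ?thesis using False by simp
    qed
    have mem: "coords_comb Basis (x(e := t)) \<in> W \<longleftrightarrow> (\<forall>b\<in>I. \<bar>x b\<bar> \<le> 1/2) \<and> \<bar>s\<bar> \<le> (v \<bullet> e) / 2 \<and>
        t \<in> {(- (v \<bullet> e) / 2 - s) / (v \<bullet> e)..((v \<bullet> e) / 2 - s) / (v \<bullet> e)}" for t
    proof -
      have x: "coords_comb Basis (x(e := t)) \<bullet> b = x b" if "b \<in> I" for b
        using that by (subst coords_comb_Basis_inner) (auto simp: I_def)
      moreover have "coords_comb Basis (x(e := t)) \<bullet> e = t"
        using e by (subst coords_comb_Basis_inner) auto
      moreover have "(\<Sum>b\<in>I. (v \<bullet> b) * (coords_comb Basis (x(e := t)) \<bullet> b)) = s"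
        unfolding s_def using x by (intro sum.cong) auto
      moreover have "\<bar>(v \<bullet> e) * t + s\<bar> \<le> (v \<bullet> e) / 2 \<longleftrightarrow>
         t \<in> {(- (v \<bullet> e) / 2 - s) / (v \<bullet> e)..((v \<bullet> e) / 2 - s) / (v \<bullet> e)}"
        using abs_affine_le_iff[OF ve, of t s "(v \<bullet> e) / 2"] by simp
      ultimately show ?thesis
        unfolding W_def mem_Collect_eq inner_split[of "coords_comb Basis (x(e := t))"] by simp
    qed
    have "(\<integral>\<^sup>+t. indicator W (coords_comb Basis (x(e := t))) \<partial>lborel) =
      (\<integral>\<^sup>+t. (P * indicator {- (v \<bullet> e) / 2..(v \<bullet> e) / 2} s) *
         indicator {(- (v \<bullet> e) / 2 - s) / (v \<bullet> e)..((v \<bullet> e) / 2 - s) / (v \<bullet> e)} t \<partial>lborel)"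
    proof (intro nn_integral_cong)
      fix t
      have "s \<in> {- (v \<bullet> e) / 2..(v \<bullet> e) / 2} \<longleftrightarrow> \<bar>s\<bar> \<le> (v \<bullet> e) / 2" by auto
      then show "indicator W (coords_comb Basis (x(e := t))) = P * indicator {- (v \<bullet> e) / 2..(v \<bullet> e) / 2} s *
         indicator {(- (v \<bullet> e) / 2 - s) / (v \<bullet> e)..((v \<bullet> e) / 2 - s) / (v \<bullet> e)} t"
        unfolding P indicator_def mem by (simp only: of_bool_conj mult.assoc)
    qed
    also have "\<dots> = P * indicator {- (v \<bullet> e) / 2..(v \<bullet> e) / 2} s * ennreal (((v \<bullet> e) / 2 - s) / (v \<bullet> e) - (- (v \<bullet> e) / 2 - s) / (v \<bullet> e))"
      using ve by (subst nn_integral_cmult_indicator) (auto simp: divide_right_mono)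
    also have "((v \<bullet> e) / 2 - s) / (v \<bullet> e) - (- (v \<bullet> e) / 2 - s) / (v \<bullet> e) = 1"
      using ve by (simp add: field_simps)
    finally show "(\<integral>\<^sup>+t. indicator W (coords_comb Basis (x(e := t))) \<partial>lborel) =
       (\<Prod>b\<in>I. indicator {-1/2..1/2} (x b)) * indicator {- (v \<bullet> e) / 2..(v \<bullet> e) / 2} (\<Sum>b\<in>I. (v \<bullet> b) * x b)"
      unfolding P_def s_def by (simp only: mult_1_right ennreal_1)
  qed
  finally have W1: "emeasure lborel W = cube_int I (\<lambda>b. v \<bullet> b) (indicator {- (v \<bullet> e) / 2..(v \<bullet> e) / 2})" .

  define u where "u = v /\<^sub>R norm v"
  have u: "norm u = 1" "v \<bullet> u = norm v"
    using v0 by (simp_all add: u_def power2_norm_eq_inner[symmetric] power2_eq_square)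
  have BH: "v \<bullet> b = 0" if "b \<in> span B" for b using that B(2) by auto
  have uB: "u \<notin> B" using u(2) nv BH[OF span_base] by force
  have fin: "finite B" using B(1) by (rule orthonormal_set_finite)
  have onb: "orthonormal_set (insert u B)"
    using B(1) u(1) BH[OF span_base] unfolding orthonormal_set_def
    by (auto simp: pairwise_insert orthogonal_def u_def inner_commute)
  have "card B = dim {x. v \<bullet> x = 0}"
    using indep_card_eq_dim_span[OF orthonormal_set_independent[OF B(1)]] B(2) dim_span[of B] by simp
  then have card: "card (insert u B) = DIM('a)"
    using dim_hyperplane[OF v0] fin uB DIM_positive[where 'a = 'a] by simp

  \<comment> \<open>The unit normal and the subtracted multiple of e have the same inner product
    with v, so h is parallel to the hyperplane, and the slice of \<open>W\<close> at height t is
    \<open>K\<close> translated by - t h.\<close>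
  define h where "h = u - (norm v / (v \<bullet> e)) *\<^sub>R e"
  have h: "t *\<^sub>R h \<in> span B" for t
    unfolding B(2) using u(2) ve by (simp add: h_def inner_diff_right)
  define S where "S = (\<integral>\<^sup>+f. indicator K (coords_comb B f) \<partial>Pi\<^sub>M B (\<lambda>_. lborel))"
  have mem: "t *\<^sub>R u + y \<in> W \<longleftrightarrow> y + t *\<^sub>R h \<in> K \<and> t \<in> {- (v \<bullet> e) / 2 / norm v..(v \<bullet> e) / 2 / norm v}"
    if "y \<in> span B" for t y
  proof -
    define x where "x = t *\<^sub>R u + y"
    define q where "q = y + t *\<^sub>R h"
    have qx: "q = x - (t * norm v / (v \<bullet> e)) *\<^sub>R e"
      by (simp add: q_def x_def h_def scaleR_diff_right)
    have vq: "v \<bullet> q = 0" using BH[OF span_add[OF that h]] by (simp add: q_def)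
    have qb: "q \<bullet> b = x \<bullet> b" if "b \<in> I" for b
    proof -
      have "e \<bullet> b = 0" using that e by (intro inner_not_same_Basis) (auto simp: I_def)
      then show ?thesis by (simp add: qx inner_diff_left)
    qed
    have vx: "v \<bullet> x = t * norm v"
      using BH[OF that] u(2) by (simp add: x_def inner_add_right)
    have sum: "(\<Sum>b\<in>I. (v \<bullet> b) * (x \<bullet> b)) = (\<Sum>b\<in>I. (v \<bullet> b) * (q \<bullet> b))"
      using qb by (intro sum.cong) auto
    have "(v \<bullet> e) * (q \<bullet> e) = - (\<Sum>b\<in>I. (v \<bullet> b) * (q \<bullet> b))"
      using inner_split[of q] vq by linarith
    then have "\<bar>\<Sum>b\<in>I. (v \<bullet> b) * (x \<bullet> b)\<bar> = (v \<bullet> e) * \<bar>q \<bullet> e\<bar>"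
      unfolding sum using ve by (metis abs_minus_cancel abs_mult abs_of_pos)
    moreover have "(v \<bullet> e) * \<bar>q \<bullet> e\<bar> \<le> (v \<bullet> e) / 2 \<longleftrightarrow> \<bar>q \<bullet> e\<bar> \<le> 1/2"
      using ve by (simp add: field_simps)
    moreover have "\<bar>t * norm v\<bar> \<le> (v \<bullet> e) / 2 \<longleftrightarrow> t \<in> {- (v \<bullet> e) / 2 / norm v..(v \<bullet> e) / 2 / norm v}"
      using abs_affine_le_iff[OF nv, of t 0 "(v \<bullet> e) / 2"] by (simp add: mult.commute)
    ultimately have "x \<in> W \<longleftrightarrow> (\<forall>b\<in>I. \<bar>q \<bullet> b\<bar> \<le> 1/2) \<and> \<bar>q \<bullet> e\<bar> \<le> 1/2 \<and>
        t \<in> {- (v \<bullet> e) / 2 / norm v..(v \<bullet> e) / 2 / norm v}"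
      unfolding W_def mem_Collect_eq vx by (simp add: qb)
    then show ?thesis
      unfolding x_def[symmetric] q_def[symmetric] K_def I(3)[symmetric] using vq by auto
  qed
  have "emeasure lborel W = (\<integral>\<^sup>+f. indicator W (coords_comb (insert u B) f) \<partial>Pi\<^sub>M (insert u B) (\<lambda>_. lborel))"
    by (intro emeasure_lborel_orthonormal onb card) auto
  also have "\<dots> = (\<integral>\<^sup>+t. \<integral>\<^sup>+f. indicator W (coords_comb (insert u B) (f(u := t))) \<partial>Pi\<^sub>M B (\<lambda>_. lborel) \<partial>lborel)"
    by (rule lborel_PiM.product_nn_integral_insert_rev) (use fin uB in measurable)
  also have "\<dots> = (\<integral>\<^sup>+t. S * indicator {- (v \<bullet> e) / 2 / norm v..(v \<bullet> e) / 2 / norm v} t \<partial>lborel)"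
  proof (intro nn_integral_cong)
    fix t :: real
    have "coords_comb (insert u B) (f(u := t)) = t *\<^sub>R u + coords_comb B f" for f
    proof -
      have "(\<Sum>b\<in>B. (f(u := t)) b *\<^sub>R b) = (\<Sum>b\<in>B. f b *\<^sub>R b)"
        using uB by (intro sum.cong) auto
      then show ?thesis using fin uB unfolding coords_comb_def by (simp del: fun_upd_apply) simp
    qed
    moreover have "coords_comb B f \<in> span B" for f
      unfolding coords_comb_def by (intro span_sum span_scale span_base)
    ultimately have "(\<integral>\<^sup>+f. indicator W (coords_comb (insert u B) (f(u := t))) \<partial>Pi\<^sub>M B (\<lambda>_. lborel)) =
      (\<integral>\<^sup>+f. indicator K (coords_comb B f + t *\<^sub>R h) * indicator {- (v \<bullet> e) / 2 / norm v..(v \<bullet> e) / 2 / norm v} t \<partial>Pi\<^sub>M B (\<lambda>_. lborel))"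
      by (intro nn_integral_cong) (simp add: indicator_def mem)
    also have "\<dots> = (\<integral>\<^sup>+f. indicator K (coords_comb B f + t *\<^sub>R h) \<partial>Pi\<^sub>M B (\<lambda>_. lborel)) *
        indicator {- (v \<bullet> e) / 2 / norm v..(v \<bullet> e) / 2 / norm v} t"
      by (rule nn_integral_multc) measurable
    also have "(\<integral>\<^sup>+f. indicator K (coords_comb B f + t *\<^sub>R h) \<partial>Pi\<^sub>M B (\<lambda>_. lborel)) = S"
      unfolding S_def by (intro nn_integral_coords_comb_translate B(1) h) measurable
    finally show "(\<integral>\<^sup>+f. indicator W (coords_comb (insert u B) (f(u := t))) \<partial>Pi\<^sub>M B (\<lambda>_. lborel)) =
      S * indicator {- (v \<bullet> e) / 2 / norm v..(v \<bullet> e) / 2 / norm v} t" .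
  qed
  also have "\<dots> = S * ennreal ((v \<bullet> e) / 2 / norm v - - (v \<bullet> e) / 2 / norm v)"
    using ve nv by (subst nn_integral_cmult_indicator) (auto simp: divide_right_mono)
  also have "(v \<bullet> e) / 2 / norm v - - (v \<bullet> e) / 2 / norm v = v \<bullet> e / norm v"
    by simp
  finally show ?thesis
    using W1 unfolding S_def K_def I_def by simp
qed

text \<open>The section volume on any Euclidean space, with basis vectors instead of indices as
  names of the coordinates, so that it fits \<open>cube_int\<close> over subsets of
  \<open>Basis\<close>.\<close>

definition cube_section :: "'a::euclidean_space \<Rightarrow> real" where
  "cube_section v = measure (subspace_lborel {x. v \<bullet> x = 0}) ({x. \<forall>b\<in>Basis. \<bar>x \<bullet> b\<bar> \<le> 1/2} \<inter> {x. v \<bullet> x = 0})"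

lemma cube_section_eq:
  fixes v e :: "'a::euclidean_space"
  assumes e: "e \<in> Basis" and ve: "v \<bullet> e > 0"
  shows "cube_section v =
    norm v / (v \<bullet> e) * enn2real (cube_int (Basis - {e}) (\<lambda>b. v \<bullet> b) (indicator {- (v \<bullet> e) / 2..(v \<bullet> e) / 2}))"
proof -
  define H where "H = {x. v \<bullet> x = 0}"
  \<comment> \<open>Only orthonormality and the span of the chosen basis enter, as
    \<open>emeasure_section_eq_cube_int\<close> holds for every such basis.\<close>
  define B where "B = (SOME B. orthonormal_basis_of H B)"
  have "orthonormal_basis_of H B"
    unfolding B_def H_def by (rule someI_ex, rule orthonormal_basis_of_exists, rule subspace_hyperplane)
  then have B: "orthonormal_set B" "span B = {x. v \<bullet> x = 0}"
    unfolding orthonormal_basis_of_def orthonormal_set_def H_def by auto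
  define K where "K = {x. \<forall>b\<in>Basis. \<bar>x \<bullet> b\<bar> \<le> 1/2} \<inter> {x. v \<bullet> x = 0}"
  have "closed K"
    unfolding K_def by (rule closed_centered_cube_section)
  then have [measurable]: "K \<in> sets borel" by simp
  have "cube_section v = measure (distr (Pi\<^sub>M B (\<lambda>_. lborel)) borel (coords_comb B)) K"
    unfolding cube_section_def subspace_lborel_def H_def[symmetric] B_def[symmetric] Let_def
      K_def coords_comb_def[abs_def] ..
  also have "\<dots> = enn2real (\<integral>\<^sup>+f. indicator K (coords_comb B f) \<partial>Pi\<^sub>M B (\<lambda>_. lborel))"
  proof -
    have "emeasure (distr (Pi\<^sub>M B (\<lambda>_. lborel)) borel (coords_comb B)) K =
      (\<integral>\<^sup>+x. indicator K x \<partial>distr (Pi\<^sub>M B (\<lambda>_. lborel)) borel (coords_comb B))"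
      by (subst nn_integral_indicator) auto
    also have "\<dots> = (\<integral>\<^sup>+f. indicator K (coords_comb B f) \<partial>Pi\<^sub>M B (\<lambda>_. lborel))"
      by (subst nn_integral_distr) auto
    finally show ?thesis unfolding measure_def by simp
  qed
  finally have S: "cube_section v = enn2real (\<integral>\<^sup>+f. indicator K (coords_comb B f) \<partial>Pi\<^sub>M B (\<lambda>_. lborel))" .
  have nv: "norm v > 0" using ve by auto
  have "cube_section v * (v \<bullet> e / norm v) =
    enn2real (cube_int (Basis - {e}) (\<lambda>b. v \<bullet> b) (indicator {- (v \<bullet> e) / 2..(v \<bullet> e) / 2}))"
    unfolding S K_def emeasure_section_eq_cube_int[OF e ve B, symmetric] enn2real_mult
    using ve nv by simp
  moreover have "cube_section v = norm v / (v \<bullet> e) * (cube_section v * (v \<bullet> e / norm v))"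
    using ve nv by simp
  ultimately show ?thesis by simp
qed

section \<open>Spreading two coordinates apart\<close>

lemma cube_int_slab_eq_trapezoid:
  assumes "finite J" "i \<notin> J" "w i > 0" "b > 0"
  shows "enn2real (cube_int (insert i J) w (indicator {- b / 2..b / 2})) =
    enn2real (cube_int J w (\<lambda>z. ennreal (tent ((w i + b) / 2) z - tent (\<bar>w i - b\<bar> / 2) z))) / w i"
proof -
  have slice: "(\<integral>\<^sup>+t\<in>{-1/2..1/2}. indicator {- b / 2..b / 2} (w i * t + z) \<partial>lborel) =
    ennreal (1 / w i) * ennreal (tent ((w i + b) / 2) z - tent (\<bar>w i - b\<bar> / 2) z)" for z
    unfolding nn_integral_slab_section[OF assms(3,4)] using assms(3) by (simp add: ennreal_mult'[symmetric])
  have "cube_int (insert i J) w (indicator {- b / 2..b / 2}) =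
    cube_int J w (\<lambda>z. ennreal (1 / w i) * ennreal (tent ((w i + b) / 2) z - tent (\<bar>w i - b\<bar> / 2) z))"
    unfolding slice[symmetric] by (rule cube_int_insert[OF assms(1,2)]) measurable
  also have "\<dots> = ennreal (1 / w i) * cube_int J w (\<lambda>z. ennreal (tent ((w i + b) / 2) z - tent (\<bar>w i - b\<bar> / 2) z))"
    by (intro cube_int_cmult) measurable
  finally show ?thesis using assms(3) by (simp add: enn2real_mult)
qed

text \<open>All terms are finite, so the passage to real numbers is additive. The wide tent, common
  to both vectors of a spread, can then be eliminated by linear arithmetic.\<close>

lemma cube_int_tent_split:
  assumes "finite J" "0 \<le> c" "c \<le> c'"
  shows "enn2real (cube_int J w (\<lambda>z. ennreal (tent c' z))) =
     enn2real (cube_int J w (\<lambda>z. ennreal (tent c' z - tent c z))) + enn2real (cube_int J w (\<lambda>z. ennreal (tent c z)))"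
proof -
  have fin: "cube_int J w (\<lambda>z. ennreal (tent c' z - tent c z)) < top" "cube_int J w (\<lambda>z. ennreal (tent c z)) < top"
  proof -
    have "cube_int J w (\<lambda>z. ennreal (tent c' z - tent c z)) \<le> cube_int J w (\<lambda>_. ennreal c')"
      using assms by (intro cube_int_mono ennreal_leI) (auto simp: tent_def)
    then show "cube_int J w (\<lambda>z. ennreal (tent c' z - tent c z)) < top"
      unfolding cube_int_const[OF assms(1)] by (rule le_less_trans) simp
    have "cube_int J w (\<lambda>z. ennreal (tent c z)) \<le> cube_int J w (\<lambda>_. ennreal c)"
      using assms by (intro cube_int_mono ennreal_leI) (auto simp: tent_def)
    then show "cube_int J w (\<lambda>z. ennreal (tent c z)) < top"
      unfolding cube_int_const[OF assms(1)] by (rule le_less_trans) simp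
  qed
  have "cube_int J w (\<lambda>z. ennreal (tent c' z)) = cube_int J w (\<lambda>z. ennreal (tent c' z - tent c z) + ennreal (tent c z))"
    using tent_mono[OF assms(3)] by (simp add: ennreal_plus[symmetric] del: ennreal_plus)
  also have "\<dots> = cube_int J w (\<lambda>z. ennreal (tent c' z - tent c z)) + cube_int J w (\<lambda>z. ennreal (tent c z))"
    by (intro cube_int_add) measurable
  finally show ?thesis using fin by (simp add: enn2real_plus)
qed

text \<open>The role of N is |v|^2, of q the product of the two coordinates, of d the mean of the
  trapezoid. The last hypothesis says that the right-hand value decreases to first order in
  \<Delta>. It suffices for finite \<Delta> because sqrt (N + 2 \<Delta>) \<le> sqrt N (1 + \<Delta>
  / N) and the remaining term quadratic in \<Delta> has the favourable sign.\<close>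

lemma spread_inequality:
  fixes N q \<Delta> d d' \<kappa> :: real
  assumes "N > 0" "\<Delta> > 0" "q - \<Delta> > 0" "d \<ge> 0" "d' \<ge> 0" "d' \<le> d - \<Delta> * \<kappa>" "d / q * (1 + q / N) < \<kappa>"
  shows "sqrt (N + 2 * \<Delta>) * (d' / (q - \<Delta>)) < sqrt N * (d / q)"
proof -
  have q: "q > 0" using assms by simp
  have \<kappa>: "\<kappa> > 0"
    using assms(1,4,7) q by (meson add_nonneg_nonneg divide_nonneg_pos le_less_trans mult_nonneg_nonneg zero_le_one less_imp_le)
  have "N + 2 * \<Delta> \<le> N * (1 + \<Delta> / N)\<^sup>2"
    using assms(1) by (simp add: power2_eq_square field_simps)
  then have "sqrt (N + 2 * \<Delta>) \<le> sqrt (N * (1 + \<Delta> / N)\<^sup>2)" by (rule real_sqrt_le_mono)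
  also have "\<dots> = sqrt N * (1 + \<Delta> / N)"
    using assms(1,2) by (simp add: real_sqrt_mult)
  finally have sq: "sqrt (N + 2 * \<Delta>) \<le> sqrt N * (1 + \<Delta> / N)" .
  have "d + d * q / N < \<kappa> * q"
    using assms(7) q by (simp add: field_simps)
  then have "\<Delta> * (d + d * q / N) < \<Delta> * (\<kappa> * q)" using assms(2) by (rule mult_strict_left_mono)
  moreover have "(1 + \<Delta> / N) * (d - \<Delta> * \<kappa>) * q = d * (q - \<Delta>) + \<Delta> * (d + d * q / N) - \<Delta> * (\<kappa> * q) - \<Delta> * \<Delta> * \<kappa> * q / N"
    by (simp add: algebra_simps)
  moreover have "\<Delta> * \<Delta> * \<kappa> * q / N \<ge> 0" using assms(1,2) \<kappa> q by simp
  ultimately have "(1 + \<Delta> / N) * (d - \<Delta> * \<kappa>) * q < d * (q - \<Delta>)" by linarith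
  then have key: "(1 + \<Delta> / N) * ((d - \<Delta> * \<kappa>) / (q - \<Delta>)) < d / q"
    using q assms(3) by (simp add: field_simps)
  have "sqrt (N + 2 * \<Delta>) * (d' / (q - \<Delta>)) \<le> (sqrt N * (1 + \<Delta> / N)) * ((d - \<Delta> * \<kappa>) / (q - \<Delta>))"
    using assms sq by (intro mult_mono divide_right_mono) auto
  also have "\<dots> = sqrt N * ((1 + \<Delta> / N) * ((d - \<Delta> * \<kappa>) / (q - \<Delta>)))" by simp
  also have "\<dots> < sqrt N * (d / q)"
    using key assms(1) by (intro mult_strict_left_mono) auto
  finally show ?thesis .
qed


text \<open>Here \<open>curv\<close> is the last hypothesis of \<open>spread_inequality\<close>. Its
  right side uses the half-difference of v', the larger one, because
  \<open>cube_int_tent_gain\<close> bounds the gain of the whole move by the slab of the wider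
  tent.\<close>

lemma cube_section_spread_less:
  fixes v v' :: "'a::euclidean_space"
  assumes ijk: "i \<in> Basis" "j \<in> Basis" "k \<in> Basis" "i \<noteq> j" "k \<noteq> i" "k \<noteq> j"
    and pos: "v \<bullet> i > 0" "v \<bullet> j > 0" "v' \<bullet> i > 0" "v' \<bullet> j > 0" "v \<bullet> k > 0"
    and same: "\<And>b. b \<in> Basis - {i, j} \<Longrightarrow> v' \<bullet> b = v \<bullet> b"
    and sum: "v' \<bullet> i + v' \<bullet> j = v \<bullet> i + v \<bullet> j"
    and spread: "\<bar>v \<bullet> i - v \<bullet> j\<bar> < \<bar>v' \<bullet> i - v' \<bullet> j\<bar>"
    and curv: "enn2real (cube_int (Basis - {j}) (\<lambda>b. v \<bullet> b) (indicator {- (v \<bullet> j) / 2..(v \<bullet> j) / 2})) / (v \<bullet> j)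
         * (1 + (v \<bullet> i) * (v \<bullet> j) / (norm v)\<^sup>2)
      < enn2real (cube_int (Basis - {i, j, k}) (\<lambda>b. v \<bullet> b)
          (indicator {- (v \<bullet> k / 2 - \<bar>v' \<bullet> i - v' \<bullet> j\<bar> / 2)..v \<bullet> k / 2 - \<bar>v' \<bullet> i - v' \<bullet> j\<bar> / 2})) / (v \<bullet> k)"
  shows "cube_section v' < cube_section v"
proof -
  define J :: "'a set" where "J = Basis - {i, j}"
  define L :: "'a set" where "L = Basis - {i, j, k}"
  have J: "finite J" "i \<notin> J" "Basis - {j} = insert i J" "J = insert k L" and L: "finite L" "k \<notin> L"
    using ijk by (auto simp: J_def L_def)
  define p where "p = (v \<bullet> i + v \<bullet> j) / 2"
  define s where "s = \<bar>v \<bullet> i - v \<bullet> j\<bar> / 2"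
  define s' where "s' = \<bar>v' \<bullet> i - v' \<bullet> j\<bar> / 2"
  have ss: "0 \<le> s" "s < s'" "s' \<le> p"
    using spread pos sum unfolding s_def s'_def p_def by auto
  define d where "d = enn2real (cube_int J (\<lambda>b. v \<bullet> b) (\<lambda>z. ennreal (tent p z - tent s z)))"
  define d' where "d' = enn2real (cube_int J (\<lambda>b. v \<bullet> b) (\<lambda>z. ennreal (tent p z - tent s' z)))"
  define T where "T c = cube_int J (\<lambda>b. v \<bullet> b) (\<lambda>z. ennreal (tent c z))" for c
  define C where "C = cube_int L (\<lambda>b. v \<bullet> b) (indicator {- (v \<bullet> k / 2 - s')..v \<bullet> k / 2 - s'})"
  define \<Delta> where "\<Delta> = s'\<^sup>2 - s\<^sup>2"
  define q where "q = (v \<bullet> i) * (v \<bullet> j)"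
  define N where "N = (norm v)\<^sup>2"
  have slab_v: "enn2real (cube_int (Basis - {j}) (\<lambda>b. v \<bullet> b) (indicator {- (v \<bullet> j) / 2..(v \<bullet> j) / 2})) = d / (v \<bullet> i)"
    unfolding J(3) d_def p_def s_def by (rule cube_int_slab_eq_trapezoid) (use J pos in auto)
  have slab_v': "enn2real (cube_int (Basis - {j}) (\<lambda>b. v' \<bullet> b) (indicator {- (v' \<bullet> j) / 2..(v' \<bullet> j) / 2})) = d' / (v' \<bullet> i)"
  proof -
    have "cube_int J (\<lambda>b. v' \<bullet> b) \<phi> = cube_int J (\<lambda>b. v \<bullet> b) \<phi>" for \<phi>
      using same by (intro cube_int_cong) (simp add: J_def)
    moreover have "p = (v' \<bullet> i + v' \<bullet> j) / 2" using sum by (simp add: p_def)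
    moreover have "enn2real (cube_int (insert i J) (\<lambda>b. v' \<bullet> b) (indicator {- (v' \<bullet> j) / 2..(v' \<bullet> j) / 2})) =
        enn2real (cube_int J (\<lambda>b. v' \<bullet> b) (\<lambda>z. ennreal (tent ((v' \<bullet> i + v' \<bullet> j) / 2) z - tent (\<bar>v' \<bullet> i - v' \<bullet> j\<bar> / 2) z)))
          / (v' \<bullet> i)"
      by (rule cube_int_slab_eq_trapezoid) (use J(1,2) pos in auto)
    ultimately show ?thesis
      unfolding J(3) d'_def s'_def by (simp only:)
  qed
  have sec_v: "cube_section v = sqrt N * (d / q)"
    unfolding cube_section_eq[OF ijk(2) pos(2)] slab_v q_def N_def by (simp add: mult.commute)
  have Delta: "\<Delta> > 0" using ss by (simp add: \<Delta>_def power_strict_mono)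
  have q': "(v' \<bullet> i) * (v' \<bullet> j) = q - \<Delta>"
  proof -
    have four: "4 * (a * b) = (a + b)\<^sup>2 - \<bar>a - b\<bar>\<^sup>2" for a b :: real
      by (simp add: power2_eq_square algebra_simps)
    have "4 * ((v' \<bullet> i) * (v' \<bullet> j)) = (v \<bullet> i + v \<bullet> j)\<^sup>2 - \<bar>v' \<bullet> i - v' \<bullet> j\<bar>\<^sup>2"
      unfolding four sum ..
    moreover have "4 * q = (v \<bullet> i + v \<bullet> j)\<^sup>2 - \<bar>v \<bullet> i - v \<bullet> j\<bar>\<^sup>2"
      unfolding q_def four ..
    moreover have "4 * \<Delta> = \<bar>v' \<bullet> i - v' \<bullet> j\<bar>\<^sup>2 - \<bar>v \<bullet> i - v \<bullet> j\<bar>\<^sup>2"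
      unfolding \<Delta>_def s_def s'_def power_divide by simp
    ultimately show ?thesis by linarith
  qed
  have N': "(norm v')\<^sup>2 = N + 2 * \<Delta>"
  proof -
    have split: "(norm x)\<^sup>2 = (x \<bullet> i)\<^sup>2 + (x \<bullet> j)\<^sup>2 + (\<Sum>b\<in>J. (x \<bullet> b)\<^sup>2)" for x
    proof -
      have "(norm x)\<^sup>2 = (\<Sum>b\<in>Basis. (x \<bullet> b)\<^sup>2)"
        unfolding power2_norm_eq_inner by (subst euclidean_inner) (simp add: power2_eq_square)
      also have "Basis = insert i (insert j J)" using ijk by (auto simp: J_def)
      finally show ?thesis using ijk(4) J(1) by (simp add: J_def)
    qed
    have "(\<Sum>b\<in>J. (v' \<bullet> b)\<^sup>2) = (\<Sum>b\<in>J. (v \<bullet> b)\<^sup>2)"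
      using same by (intro sum.cong) (auto simp: J_def)
    moreover have "(v' \<bullet> i)\<^sup>2 + (v' \<bullet> j)\<^sup>2 = (v \<bullet> i)\<^sup>2 + (v \<bullet> j)\<^sup>2 + 2 * \<Delta>"
    proof -
      have "(v' \<bullet> i)\<^sup>2 + (v' \<bullet> j)\<^sup>2 = (v' \<bullet> i + v' \<bullet> j)\<^sup>2 - 2 * ((v' \<bullet> i) * (v' \<bullet> j))"
        by (simp add: power2_eq_square algebra_simps)
      also have "\<dots> = (v \<bullet> i + v \<bullet> j)\<^sup>2 - 2 * (q - \<Delta>)" unfolding q' sum ..
      finally show ?thesis unfolding q_def by (simp add: power2_eq_square algebra_simps)
    qed
    ultimately show ?thesis unfolding N_def split by simp
  qed
  have sec_v': "cube_section v' = sqrt (N + 2 * \<Delta>) * (d' / (q - \<Delta>))"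
    unfolding cube_section_eq[OF ijk(2) pos(4)] slab_v' q'[symmetric] N'[symmetric] by (simp add: mult.commute)
  have gain: "T s + ennreal (\<Delta> / (v \<bullet> k)) * C \<le> T s'"
    unfolding T_def C_def \<Delta>_def J(4) using ss L pos by (intro cube_int_tent_gain) auto
  have T_fin: "T c \<noteq> top" for c
  proof -
    have "T c \<le> cube_int J (\<lambda>b. v \<bullet> b) (\<lambda>_. ennreal \<bar>c\<bar>)"
      unfolding T_def by (intro cube_int_mono ennreal_leI) (auto simp: tent_def)
    also have "\<dots> = ennreal \<bar>c\<bar>" by (rule cube_int_const[OF J(1)])
    finally show ?thesis by (auto simp: top_unique)
  qed
  have "enn2real (T s + ennreal (\<Delta> / (v \<bullet> k)) * C) \<le> enn2real (T s')"
    using T_fin gain by (intro enn2real_mono) (auto simp: less_top)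
  moreover have "ennreal (\<Delta> / (v \<bullet> k)) * C \<noteq> top"
    using gain T_fin[of s'] by (auto simp: top_unique)
  ultimately have gain': "enn2real (T s) + \<Delta> * (enn2real C / (v \<bullet> k)) \<le> enn2real (T s')"
    using T_fin[of s] Delta pos(5) by (simp add: enn2real_plus enn2real_mult less_top)
  have "enn2real (T p) = d + enn2real (T s)"
    unfolding T_def d_def using J(1) ss by (intro cube_int_tent_split) auto
  moreover have "enn2real (T p) = d' + enn2real (T s')"
    unfolding T_def d'_def using J(1) ss by (intro cube_int_tent_split) auto
  ultimately have loss: "d' \<le> d - \<Delta> * (enn2real C / (v \<bullet> k))"
    using gain' by linarith
  have "v \<noteq> 0" using pos by auto
  then have "N > 0" by (simp add: N_def)
  moreover have "q - \<Delta> > 0" unfolding q'[symmetric] using pos by simp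
  moreover have "d / q * (1 + q / N) < enn2real C / (v \<bullet> k)"
    using curv unfolding slab_v C_def s'_def L_def q_def N_def by simp
  moreover have "d \<ge> 0" "d' \<ge> 0" by (simp_all add: d_def d'_def)
  ultimately show ?thesis
    unfolding sec_v sec_v' using Delta loss by (intro spread_inequality)
qed

section \<open>Uniform estimates near the all-ones vector\<close>

lemma cube_int_unit_slab_eq_spline:
  assumes "finite I" "I \<noteq> {}"
  shows "cube_int I (\<lambda>_. 1) (indicator {- (1/2)..1/2}) = ennreal (spline (card I) 0)"
  using cube_int_ones_eq_spline[OF assms, of 0] by simp

text \<open>First the weights are changed to 1 at the cost of a wider slab, then the half-width is
  brought back to 1/2. The Lipschitz bound comes second since it asks for a weight equal to 1. The
  number r is the total excess of half-width; the lower bound below is dual.\<close>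

lemma enn2real_slab_le:
  assumes "finite I" "I \<noteq> {}" "\<delta> \<ge> 0" "\<And>i. i \<in> I \<Longrightarrow> \<bar>w i - 1\<bar> \<le> \<delta>" "c + real (card I) * \<delta> / 2 \<le> 1/2 + r" "r \<ge> 0"
  shows "enn2real (cube_int I w (indicator {- c..c})) \<le> spline (card I) 0 + 2 * r"
proof -
  have sp: "spline (card I) 0 \<ge> 0"
    using assms by (intro spline_nonneg) (simp add: Suc_le_eq card_gt_0_iff)
  obtain k where k: "k \<in> I" using assms(2) by blast
  have "cube_int I w (indicator {- c..c}) \<le> cube_int I (\<lambda>_. 1) (indicator {- (1/2 + r)..1/2 + r})"
  proof (rule cube_int_perturb[OF assms(1,4)])
    fix z z' :: real
    assume "\<bar>z - z'\<bar> \<le> real (card I) * \<delta> / 2"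
    then have "z' \<in> {- (1/2 + r)..1/2 + r}" if "z \<in> {- c..c}"
      using that assms(5) unfolding atLeastAtMost_iff by linarith
    then show "indicator {- c..c} z \<le> (indicator {- (1/2 + r)..1/2 + r} z' :: ennreal)"
      by (auto split: split_indicator)
  qed
  also have "\<dots> \<le> cube_int I (\<lambda>_. 1) (indicator {- (1/2)..1/2}) + ennreal (2 * (1/2 + r - 1/2))"
    using assms(6) by (intro cube_int_slab_lipschitz[OF assms(1) k]) auto
  also have "\<dots> = ennreal (spline (card I) 0 + 2 * r)"
    unfolding cube_int_unit_slab_eq_spline[OF assms(1,2)] using sp assms(6) by (subst ennreal_plus[symmetric]) auto
  finally show ?thesis
    using sp assms(6) by (intro enn2real_leI) auto
qed

lemma enn2real_slab_ge:
  assumes "finite I" "I \<noteq> {}" "\<delta> \<ge> 0" "\<And>i. i \<in> I \<Longrightarrow> \<bar>w i - 1\<bar> \<le> \<delta>" "1/2 - r + real (card I) * \<delta> / 2 \<le> c" "r \<ge> 0"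
  shows "spline (card I) 0 - 2 * r \<le> enn2real (cube_int I w (indicator {- c..c}))"
proof -
  obtain k where k: "k \<in> I" using assms(2) by blast
  have fin: "cube_int I w (indicator {- c..c}) \<noteq> top"
  proof -
    have "cube_int I w (indicator {- c..c}) \<le> cube_int I w (\<lambda>_. 1)"
      by (intro cube_int_mono) (auto simp: indicator_def)
    then show ?thesis unfolding cube_int_const[OF assms(1)] by (auto simp: top_unique)
  qed
  have "ennreal (spline (card I) 0) = cube_int I (\<lambda>_. 1) (indicator {- (1/2)..1/2})"
    by (rule cube_int_unit_slab_eq_spline[OF assms(1,2), symmetric])
  also have "\<dots> \<le> cube_int I (\<lambda>_. 1) (indicator {- (1/2 - r)..1/2 - r}) + ennreal (2 * (1/2 - (1/2 - r)))"
    using assms(6) by (intro cube_int_slab_lipschitz[OF assms(1) k]) auto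
  also have "cube_int I (\<lambda>_. 1) (indicator {- (1/2 - r)..1/2 - r}) \<le> cube_int I w (indicator {- c..c})"
  proof (rule cube_int_perturb[OF assms(1)])
    fix z z' :: real
    assume "\<bar>z - z'\<bar> \<le> real (card I) * \<delta> / 2"
    then have "z' \<in> {- c..c}" if "z \<in> {- (1/2 - r)..1/2 - r}"
      using that assms(5) unfolding atLeastAtMost_iff by linarith
    then show "indicator {- (1/2 - r)..1/2 - r} z \<le> (indicator {- c..c} z' :: ennreal)"
      by (auto split: split_indicator)
  qed (use assms(4) in \<open>simp add: abs_minus_commute\<close>)
  finally have "ennreal (spline (card I) 0) \<le> cube_int I w (indicator {- c..c}) + ennreal (2 * r)"
    by (simp add: add_right_mono)
  also have "\<dots> = ennreal (enn2real (cube_int I w (indicator {- c..c})) + 2 * r)"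
    using fin assms(6) by (simp add: ennreal_plus less_top[symmetric] ennreal_enn2real_if)
  finally show ?thesis
    using assms(6) by (subst (asm) ennreal_le_iff) auto
qed

text \<open>A sup-norm ball, so that replacing two coordinates by values between them does not leave
  it.\<close>

definition near_ones :: "real \<Rightarrow> 'a::euclidean_space set" where
  "near_ones \<delta> = {v. \<forall>b\<in>Basis. \<bar>v \<bullet> b - 1\<bar> \<le> \<delta>}"

text \<open>Each quantity in \<open>curv\<close> is replaced by its worst value on
  \<open>near_ones\<close>. The resulting \<open>margin\<close> involves only the dimension and
  \<delta>, so it serves every move of the final induction.\<close>

lemma cube_section_spread_less_near_ones:
  fixes v v' :: "'a::euclidean_space"
  assumes dim: "DIM('a) \<ge> 4" and \<delta>: "0 < \<delta>" "\<delta> < 1"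
    and margin: "(spline (DIM('a) - 1) 0 + real DIM('a) * \<delta>) / (1 - \<delta>) * (1 + (1 + \<delta>)\<^sup>2 / (real DIM('a) * (1 - \<delta>)\<^sup>2))
       < (spline (DIM('a) - 3) 0 - real DIM('a) * \<delta>) / (1 + \<delta>)"
    and near: "v \<in> near_ones \<delta>" "v' \<in> near_ones \<delta>"
    and ij: "i \<in> Basis" "j \<in> Basis" "i \<noteq> j"
    and same: "\<And>b. b \<in> Basis - {i, j} \<Longrightarrow> v' \<bullet> b = v \<bullet> b"
    and sum: "v' \<bullet> i + v' \<bullet> j = v \<bullet> i + v \<bullet> j"
    and spread: "\<bar>v \<bullet> i - v \<bullet> j\<bar> < \<bar>v' \<bullet> i - v' \<bullet> j\<bar>"
  shows "cube_section v' < cube_section v"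
proof -
  define n where "n = real DIM('a)"
  have n: "n \<ge> 4" using dim by (simp add: n_def)
  have bounds: "1 - \<delta> \<le> v \<bullet> b" "v \<bullet> b \<le> 1 + \<delta>" "1 - \<delta> \<le> v' \<bullet> b" "v' \<bullet> b \<le> 1 + \<delta>" if "b \<in> Basis" for b
    using near that by (auto simp: near_ones_def abs_le_iff)
  then have pos: "v \<bullet> b > 0" "v' \<bullet> b > 0" if "b \<in> Basis" for b
    using that \<delta>(2) by fastforce+
  have "card (Basis - {i, j}) = DIM('a) - 2"
    using ij by (simp add: card_Diff_subset)
  then have "Basis - {i, j} \<noteq> {}" using dim by (intro notI) simp
  then obtain k where k: "k \<in> Basis" "k \<noteq> i" "k \<noteq> j" by auto
  have card1: "card (Basis - {j}) = DIM('a) - 1" "Basis - {j} \<noteq> {}"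
    using ij by auto
  have card3: "card (Basis - {i, j, k}) = DIM('a) - 3"
    using ij k by (subst card_Diff_subset) auto
  \<comment> \<open>Dimension at least 4 leaves a coordinate besides i, j and k, so that the spline
    index n - 3 is at least 1.\<close>
  then have ne3: "Basis - {i, j, k} \<noteq> {}" using dim by (intro notI) simp
  define s' where "s' = \<bar>v' \<bullet> i - v' \<bullet> j\<bar> / 2"
  have s': "s' \<le> \<delta>" using bounds[OF ij(1)] bounds[OF ij(2)] by (simp add: s'_def abs_le_iff)
  define \<psi> where "\<psi> = enn2real (cube_int (Basis - {j}) (\<lambda>b. v \<bullet> b) (indicator {- (v \<bullet> j / 2)..v \<bullet> j / 2}))"
  define \<kappa> where "\<kappa> = enn2real (cube_int (Basis - {i, j, k}) (\<lambda>b. v \<bullet> b) (indicator {- (v \<bullet> k / 2 - s')..v \<bullet> k / 2 - s'}))"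
  have near': "\<bar>v \<bullet> b - 1\<bar> \<le> \<delta>" if "b \<in> Basis" for b
    using near(1) that by (simp add: near_ones_def)
  \<comment> \<open>The excess n \<delta> / 2 is (n - 1) \<delta> / 2 from the weights plus \<delta>
    / 2 from the half-width. In the lower bound for \<kappa> it is (n - 3) \<delta> / 2 + \<delta> /
    2 + \<delta>, the last term bounding s'.\<close>
  have "\<psi> \<le> spline (card (Basis - {j})) 0 + 2 * (n * \<delta> / 2)"
    unfolding \<psi>_def
  proof (rule enn2real_slab_le[where \<delta> = \<delta>])
    have "real (card (Basis - {j})) * \<delta> = n * \<delta> - \<delta>"
      unfolding card1 n_def using dim by (simp add: of_nat_diff algebra_simps)
    then show "v \<bullet> j / 2 + real (card (Basis - {j})) * \<delta> / 2 \<le> 1 / 2 + n * \<delta> / 2"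
      using bounds(2)[OF ij(2)] by linarith
  qed (use card1 near' \<delta> n in auto)
  then have \<psi>: "\<psi> \<le> spline (DIM('a) - 1) 0 + n * \<delta>" by (simp add: card1)
  have "spline (card (Basis - {i, j, k})) 0 - 2 * (n * \<delta> / 2) \<le> \<kappa>"
    unfolding \<kappa>_def
  proof (rule enn2real_slab_ge[where \<delta> = \<delta>])
    have "real (card (Basis - {i, j, k})) * \<delta> = n * \<delta> - 3 * \<delta>"
      unfolding card3 n_def using dim by (simp add: of_nat_diff algebra_simps)
    then show "1 / 2 - n * \<delta> / 2 + real (card (Basis - {i, j, k})) * \<delta> / 2 \<le> v \<bullet> k / 2 - s'"
      using bounds(1)[OF k(1)] s' by linarith
  qed (use ne3 near' \<delta> n in auto)
  then have \<kappa>: "spline (DIM('a) - 3) 0 - n * \<delta> \<le> \<kappa>" by (simp add: card3)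
  have sp: "spline (DIM('a) - 1) 0 \<ge> 0" using dim by (intro spline_nonneg) auto
  have norm: "n * (1 - \<delta>)\<^sup>2 \<le> (norm v)\<^sup>2"
  proof -
    have "n * (1 - \<delta>)\<^sup>2 = (\<Sum>b\<in>(Basis::'a set). (1 - \<delta>)\<^sup>2)" by (simp add: n_def)
    also have "\<dots> \<le> (\<Sum>b\<in>Basis. (v \<bullet> b)\<^sup>2)"
      using bounds(1) \<delta>(2) by (intro sum_mono power_mono) auto
    also have "\<dots> = (norm v)\<^sup>2"
      using euclidean_inner[of v v] unfolding power2_norm_eq_inner by (simp only: power2_eq_square)
    finally show ?thesis .
  qed
  have ratio: "(v \<bullet> i) * (v \<bullet> j) / (norm v)\<^sup>2 \<le> (1 + \<delta>)\<^sup>2 / (n * (1 - \<delta>)\<^sup>2)"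
  proof (rule frac_le)
    show "(v \<bullet> i) * (v \<bullet> j) \<le> (1 + \<delta>)\<^sup>2"
      unfolding power2_eq_square using bounds(2) pos(1) ij \<delta> by (intro mult_mono) (auto simp: less_imp_le)
    show "0 < n * (1 - \<delta>)\<^sup>2" using n \<delta> by simp
  qed (use norm in auto)
  have r0: "(v \<bullet> i) * (v \<bullet> j) / (norm v)\<^sup>2 \<ge> 0" using pos ij by (simp add: less_imp_le)
  have "\<psi> / (v \<bullet> j) \<le> (spline (DIM('a) - 1) 0 + n * \<delta>) / (1 - \<delta>)"
    using \<psi> bounds(1)[OF ij(2)] \<delta> n sp by (intro frac_le) auto
  then have "\<psi> / (v \<bullet> j) * (1 + (v \<bullet> i) * (v \<bullet> j) / (norm v)\<^sup>2)
     \<le> (spline (DIM('a) - 1) 0 + n * \<delta>) / (1 - \<delta>) * (1 + (1 + \<delta>)\<^sup>2 / (n * (1 - \<delta>)\<^sup>2))"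
    using ratio r0 n \<delta> sp by (intro mult_mono) (auto intro!: divide_nonneg_nonneg)
  also have "\<dots> < (spline (DIM('a) - 3) 0 - n * \<delta>) / (1 + \<delta>)"
    using margin unfolding n_def .
  also have "\<dots> \<le> \<kappa> / (v \<bullet> k)"
  proof (rule frac_le)
    show "0 \<le> \<kappa>" by (simp add: \<kappa>_def)
  qed (use \<kappa> bounds(2)[OF k(1)] pos(1)[OF k(1)] in auto)
  finally have "\<psi> / (v \<bullet> j) * (1 + (v \<bullet> i) * (v \<bullet> j) / (norm v)\<^sup>2) < \<kappa> / (v \<bullet> k)" .
  moreover have "- (v \<bullet> j) / 2 = - (v \<bullet> j / 2)" by simp
  ultimately have curv: "enn2real (cube_int (Basis - {j}) (\<lambda>b. v \<bullet> b) (indicator {- (v \<bullet> j) / 2..v \<bullet> j / 2})) / (v \<bullet> j)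
         * (1 + (v \<bullet> i) * (v \<bullet> j) / (norm v)\<^sup>2) < \<kappa> / (v \<bullet> k)"
    unfolding \<psi>_def by (simp only:)
  show ?thesis
    by (rule cube_section_spread_less[OF ij(1,2) k(1) ij(3) k(2,3) pos(1)[OF ij(1)] pos(1)[OF ij(2)]
          pos(2)[OF ij(1)] pos(2)[OF ij(2)] pos(1)[OF k(1)] same sum spread
          curv[unfolded \<kappa>_def s'_def]])
qed

text \<open>Moving one coordinate at a time to the value 1, at the expense of a coordinate on the other side
  of 1, reaches the main diagonal after finitely many steps.\<close>

lemma cube_section_less_ones:
  fixes v :: "'a::euclidean_space"
  assumes dim: "DIM('a) \<ge> 4" and \<delta>: "0 < \<delta>" "\<delta> < 1"
    and margin: "(spline (DIM('a) - 1) 0 + real DIM('a) * \<delta>) / (1 - \<delta>) * (1 + (1 + \<delta>)\<^sup>2 / (real DIM('a) * (1 - \<delta>)\<^sup>2))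
       < (spline (DIM('a) - 3) 0 - real DIM('a) * \<delta>) / (1 + \<delta>)"
  shows "v \<in> near_ones \<delta> \<Longrightarrow> (\<Sum>b\<in>Basis. v \<bullet> b) = real DIM('a) \<Longrightarrow> v \<noteq> One \<Longrightarrow> cube_section v < cube_section (One :: 'a)"
proof (induction "card {b\<in>Basis. v \<bullet> b \<noteq> 1}" arbitrary: v rule: less_induct)
  case less
  obtain b where b: "b \<in> Basis" "v \<bullet> b \<noteq> 1"
    using less.prems(3) by (auto simp: euclidean_eq_iff[of v])
  have sum0: "(\<Sum>b\<in>Basis. v \<bullet> b - 1) = 0" using less.prems(2) by (simp add: sum_subtractf)
  have "\<exists>i\<in>Basis. v \<bullet> i < 1"
  proof (rule ccontr)
    assume "\<not> ?thesis"
    then have "\<forall>b\<in>Basis. v \<bullet> b - 1 = 0"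
      using sum0 by (subst (asm) sum_nonneg_eq_0_iff) (auto simp: not_less)
    then show False using b by simp
  qed
  then obtain i where i: "i \<in> Basis" "v \<bullet> i < 1" by blast
  have "\<exists>j\<in>Basis. v \<bullet> j > 1"
  proof (rule ccontr)
    assume *: "\<not> ?thesis"
    have "(\<Sum>b\<in>Basis. 1 - v \<bullet> b) = 0" using less.prems(2) by (simp add: sum_subtractf)
    with * have "\<forall>b\<in>Basis. 1 - v \<bullet> b = 0"
      by (subst (asm) sum_nonneg_eq_0_iff) (auto simp: not_less)
    then show False using b by simp
  qed
  then obtain j where j: "j \<in> Basis" "v \<bullet> j > 1" by blast
  have ij: "i \<noteq> j" using i j by auto
  \<comment> \<open>The sum is kept, and both new coordinates lie between v \<bullet> i and v
    \<bullet> j, hence \<open>w\<close> remains in \<open>near_ones\<close> and the two coordinates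
    come closer together.\<close>
  define w where "w = v + (1 - v \<bullet> i) *\<^sub>R i - (1 - v \<bullet> i) *\<^sub>R j"
  have w: "w \<bullet> b = (if b = i then 1 else if b = j then v \<bullet> j + v \<bullet> i - 1 else v \<bullet> b)" if "b \<in> Basis" for b
    using that i j ij by (auto simp: w_def inner_diff_left inner_add_left inner_Basis)
  have near: "w \<in> near_ones \<delta>"
  proof -
    have "\<bar>v \<bullet> b - 1\<bar> \<le> \<delta>" if "b \<in> Basis" for b
      using less.prems(1) that by (simp add: near_ones_def)
    from this[OF i(1)] this[OF j(1)] this show ?thesis
      using i(2) j(2) \<delta>(1) by (auto simp: near_ones_def w abs_le_iff)
  qed
  have sum: "(\<Sum>b\<in>Basis. w \<bullet> b) = real DIM('a)"
  proof -
    have "(\<Sum>b\<in>Basis. w \<bullet> b) = (\<Sum>b\<in>Basis. v \<bullet> b) + (1 - v \<bullet> i) * (\<Sum>b\<in>Basis. i \<bullet> b) - (1 - v \<bullet> i) * (\<Sum>b\<in>Basis. j \<bullet> b)"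
      by (simp add: w_def inner_diff_left inner_add_left sum.distrib sum_subtractf sum_distrib_left)
    moreover have "(\<Sum>b\<in>Basis. i \<bullet> b) = 1" "(\<Sum>b\<in>Basis. j \<bullet> b) = 1"
      using i j by (simp_all add: inner_Basis)
    ultimately show ?thesis using less.prems(2) by simp
  qed
  \<comment> \<open>The spreading lemma is applied in reverse: \<open>w\<close> is the less spread
    vector and v arises from it by a spread.\<close>
  have step: "cube_section v < cube_section w"
    using i j ij
    by (intro cube_section_spread_less_near_ones[OF dim \<delta> margin near less.prems(1), of i j]) (auto simp: w)
  show ?case
  proof (cases "w = One")
    case True
    then show ?thesis using step by simp
  next
    case False
    have "{b\<in>Basis. w \<bullet> b \<noteq> 1} \<subset> {b\<in>Basis. v \<bullet> b \<noteq> 1}"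
    proof
      show "{b\<in>Basis. w \<bullet> b \<noteq> 1} \<subseteq> {b\<in>Basis. v \<bullet> b \<noteq> 1}"
        using i j by (auto simp: w split: if_splits)
      have "i \<notin> {b\<in>Basis. w \<bullet> b \<noteq> 1}" "i \<in> {b\<in>Basis. v \<bullet> b \<noteq> 1}"
        using i by (auto simp: w)
      then show "{b\<in>Basis. w \<bullet> b \<noteq> 1} \<noteq> {b\<in>Basis. v \<bullet> b \<noteq> 1}" by blast
    qed
    then have "card {b\<in>Basis. w \<bullet> b \<noteq> 1} < card {b\<in>Basis. v \<bullet> b \<noteq> 1}"
      by (intro psubset_card_mono) auto
    from less.hyps[OF this near sum False] step show ?thesis by simp
  qed
qed

text \<open>At \<delta> = 0 the inequality is \<open>spline_curvature\<close> with m = n - 3, and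
  both sides are continuous there.\<close>

lemma exists_margin:
  assumes "n \<ge> 4"
  shows "\<exists>\<delta>. 0 < \<delta> \<and> \<delta> < 1 \<and>
    (spline (n - 1) 0 + real n * \<delta>) / (1 - \<delta>) * (1 + (1 + \<delta>)\<^sup>2 / (real n * (1 - \<delta>)\<^sup>2))
       < (spline (n - 3) 0 - real n * \<delta>) / (1 + \<delta>)"
proof -
  define L where "L \<delta> = (spline (n - 1) 0 + real n * \<delta>) / (1 - \<delta>) * (1 + (1 + \<delta>)\<^sup>2 / (real n * (1 - \<delta>)\<^sup>2))" for \<delta>
  define R where "R \<delta> = (spline (n - 3) 0 - real n * \<delta>) / (1 + \<delta>)" for \<delta>
  have "isCont L 0" "isCont R 0"
    unfolding L_def R_def using assms by (auto intro!: continuous_intros)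
  then have "(L \<longlongrightarrow> L 0) (at_right 0)" "(R \<longlongrightarrow> R 0) (at_right 0)"
    unfolding isCont_def by (auto intro: filterlim_at_withinI tendsto_within_subset)
  moreover have "L 0 < R 0"
  proof -
    have "Suc (Suc (n - 3)) = n - 1" "real (n - 3 + 3) = real n" using assms by auto
    then show ?thesis
      using spline_curvature[of "n - 3"] assms by (simp add: L_def R_def mult.commute)
  qed
  ultimately have "\<forall>\<^sub>F \<delta> in at_right 0. R \<delta> - L \<delta> > 0"
    by (intro order_tendstoD(1)[OF tendsto_diff]) auto
  then have "\<forall>\<^sub>F \<delta> in at_right 0. L \<delta> < R \<delta>"
    by (simp only: diff_gt_0_iff_gt)
  moreover have "\<forall>\<^sub>F \<delta> in at_right 0. \<delta> \<in> {0<..<1::real}"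
    by (rule eventually_at_right_real) simp
  ultimately have "\<forall>\<^sub>F \<delta> in at_right 0. L \<delta> < R \<delta> \<and> \<delta> \<in> {0<..<1}"
    by (rule eventually_conj)
  then obtain \<delta> where "L \<delta> < R \<delta>" "\<delta> \<in> {0<..<1}"
    using eventually_happens' trivial_limit_at_right_real by blast
  then show ?thesis by (auto simp: L_def R_def)
qed

section \<open>Transfer to the unit sphere\<close>

lemma cube_section_scaleR:
  assumes "c > 0"
  shows "cube_section (c *\<^sub>R v) = cube_section v"
  using assms by (simp add: cube_section_def)

lemma central_section_eq_cube_section:
  fixes v :: "real^'n"
  shows "central_section v = cube_section v"
proof -
  have "(-1/2 \<le> t \<and> t \<le> 1/2) = (\<bar>t\<bar> \<le> 1/2)" for t :: real by auto
  then have "centered_cube = {x::real^'n. \<forall>b\<in>Basis. \<bar>x \<bullet> b\<bar> \<le> 1/2}"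
    unfolding centered_cube_def by (auto simp: Basis_vec_def inner_axis simp del: abs_le_iff)
  then show ?thesis
    unfolding central_section_def cube_section_def orth_hyperplane_def by (simp only:)
qed

theorem theorem1p1:
  assumes "CARD('n::finite) \<ge> 4"
  shows "\<exists>U. openin (top_of_set (sphere (0 :: real^'n) 1)) U \<and> main_diagonal \<in> U \<and>
           (\<forall>v \<in> U - {main_diagonal}. central_section v < central_section (main_diagonal :: real^'n))"
proof -
  define n where "n = real CARD('n)"
  have n: "n > 0" using assms by (simp add: n_def)
  have dim: "DIM(real^'n) = CARD('n)" by simp
  obtain \<delta> where \<delta>: "0 < \<delta>" "\<delta> < 1" and margin:
    "(spline (DIM(real^'n) - 1) 0 + real DIM(real^'n) * \<delta>) / (1 - \<delta>) * (1 + (1 + \<delta>)\<^sup>2 / (real DIM(real^'n) * (1 - \<delta>)\<^sup>2))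
       < (spline (DIM(real^'n) - 3) 0 - real DIM(real^'n) * \<delta>) / (1 + \<delta>)"
    using exists_margin[of "DIM(real^'n)"] assms unfolding dim by blast
  define S where "S v = (\<Sum>b\<in>Basis. v \<bullet> b)" for v :: "real^'n"
  \<comment> \<open>For vectors with positive coordinate sum the conditions say that (n / S v) v is
    strictly within \<delta> of the all-ones vector in every coordinate; multiplied out, they are
    visibly open.\<close>
  define T where "T = {v. 0 < S v} \<inter>
    (\<Inter>b\<in>Basis. {v :: real^'n. (1 - \<delta>) * S v < n * (v \<bullet> b)} \<inter> {v. n * (v \<bullet> b) < (1 + \<delta>) * S v})"
  have "open T"
    unfolding T_def S_def by (intro open_Int open_INT ballI open_Collect_less continuous_intros) auto
  have One: "ones = (One :: real^'n)"
  proof (rule euclidean_eqI)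
    fix b :: "real^'n"
    assume b: "b \<in> Basis"
    then obtain i where "b = axis i 1" by (auto simp: Basis_vec_def)
    then have "ones \<bullet> b = 1" by (simp add: ones_def inner_axis)
    then show "ones \<bullet> b = One \<bullet> b" using b by simp
  qed
  have diag: "main_diagonal = (1 / sqrt n) *\<^sub>R (One :: real^'n)"
    unfolding main_diagonal_def n_def One ..
  have diag_sec: "cube_section (main_diagonal :: real^'n) = cube_section (One :: real^'n)"
    unfolding diag using n by (intro cube_section_scaleR) simp
  have norm_One: "norm (One :: real^'n) = sqrt n"
    using euclidean_inner[of "One :: real^'n" One] by (simp add: n_def norm_eq_sqrt_inner)
  have diag_sphere: "main_diagonal \<in> sphere (0 :: real^'n) 1"
    unfolding diag using n norm_One by simp
  have S_diag: "S (main_diagonal :: real^'n) = n / sqrt n"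
    unfolding diag S_def by (simp add: n_def)
  have "main_diagonal \<in> T"
  proof -
    have "n / sqrt n > 0" using n by simp
    then have "(1 - \<delta>) * (n / sqrt n) < 1 * (n / sqrt n)" "1 * (n / sqrt n) < (1 + \<delta>) * (n / sqrt n)"
      using \<delta>(1) by (intro mult_strict_right_mono; simp)+
    moreover have "main_diagonal \<bullet> b = 1 / sqrt n" if "b \<in> Basis" for b :: "real^'n"
      unfolding diag using that by simp
    ultimately show ?thesis
      unfolding T_def S_diag[symmetric] using \<open>n / sqrt n > 0\<close> S_diag by auto
  qed
  moreover have "central_section v < central_section (main_diagonal :: real^'n)"
    if "v \<in> sphere 0 1 \<inter> T - {main_diagonal}" for v :: "real^'n"
  proof -
    have v: "norm v = 1" "v \<noteq> main_diagonal" "S v > 0"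
      "\<And>b. b \<in> Basis \<Longrightarrow> (1 - \<delta>) * S v < n * (v \<bullet> b) \<and> n * (v \<bullet> b) < (1 + \<delta>) * S v"
      using that by (auto simp: T_def)
    \<comment> \<open>Scale invariance trades the sphere for the hyperplane of coordinate sum n,
      which spreads preserve.\<close>
    define w where "w = (n / S v) *\<^sub>R v"
    have "w \<in> near_ones \<delta>"
      unfolding near_ones_def
    proof (intro CollectI ballI)
      fix b :: "real^'n" assume "b \<in> Basis"
      from v(4)[OF this] v(3) have "1 - \<delta> < n * (v \<bullet> b) / S v" "n * (v \<bullet> b) / S v < 1 + \<delta>"
        by (simp_all add: pos_less_divide_eq pos_divide_less_eq)
      then show "\<bar>w \<bullet> b - 1\<bar> \<le> \<delta>" by (simp add: w_def abs_le_iff)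
    qed
    moreover have "(\<Sum>b\<in>Basis. w \<bullet> b) = real DIM(real^'n)"
    proof -
      have "(\<Sum>b\<in>Basis. w \<bullet> b) = n / S v * S v"
        unfolding S_def sum_distrib_left by (simp add: w_def S_def)
      then show ?thesis using v(3) by (simp add: n_def)
    qed
    moreover have "w \<noteq> One"
    proof
      assume "w = One"
      have "v = (S v / n) *\<^sub>R w" using v(3) n by (simp add: w_def)
      then have vS: "v = (S v / n) *\<^sub>R One" using \<open>w = One\<close> by simp
      have "norm v = norm ((S v / n) *\<^sub>R (One :: real^'n))" using vS by (rule arg_cong)
      then have "norm v = S v / n * sqrt n"
        unfolding norm_scaleR norm_One using v(3) n by simp
      then have "S v / n = 1 / sqrt n" using v(1) n by (simp add: eq_divide_eq)
      then show False using vS v(2) diag by simp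
    qed
    ultimately have "cube_section w < cube_section (One :: real^'n)"
      using assms by (intro cube_section_less_ones[OF _ \<delta> margin]) auto
    moreover have "cube_section w = cube_section v"
      unfolding w_def using n v(3) by (intro cube_section_scaleR) simp
    ultimately show ?thesis
      unfolding central_section_eq_cube_section diag_sec by simp
  qed
  ultimately show ?thesis
    using diag_sphere \<open>open T\<close> by (intro exI[of _ "sphere 0 1 \<inter> T"]) (auto simp: openin_open_Int)
qed

end
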